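(* Let $(E,\rho,[\cdot,\cdot]_E,R,g,{}^R\nabla)$ be a conformal Courant algebroid over $M$, regarded as a local pre-Leibniz algebroid with locality operator ${}^RL(\Omega,u,v):=g^{-1}(g(u,v)\otimes\Omega)$. A linear $E$-connection $\nabla$ is admissible if and only if it is $R$-valued $E$-metric-$g$-compatible in the sense that $${}^R\nabla_u(g(v,w))=g(\nabla_uv,w)+g(v,\nabla_uw)$$ for all $u,v,w\in\mathfrak{X}(E)$.
   Context: Everything is smooth. $M$ is a manifold, $E\to M$ a real vector bundle of constant rank, $\mathfrak{X}(E)=\Gamma(E)$, $\Omega^1(E)=\Gamma(E^* )$. An anchored vector bundle $(E,\rho)$ has a vector bundle morphism $\rho:E\to T(M)$ over the identity. An almost-Leibniz algebroid $(E,\rho,[\cdot,\cdot]_E)$ is an anchored vector bundle with an $\mathbb{R}$-bilinear bracket on $\mathfrak{X}(E)$ satisfying $[u,fv]_E=\rho(u)(f)v+f[u,v]_E$. It is pre-Leibniz if moreover $\rho([u,v]_E)=[\rho(u),\rho(v)]$, and a Leibniz algebroid if its bracket satisfies the Leibniz identity $[u,[v,w]_E]_E=[[u,v]_E,w]_E+[v,[u,w]_E]_E$. It is local with locality operator $L$, a $C^\infty(M,\mathbb{R})$-multilinear map $L:\Omega^1(E)\times\mathfrak{X}(E)\times\mathfrak{X}(E)\to\mathfrak{X}(E)$, if $[fu,v]_E=-\rho(v)(f)u+f[u,v]_E+L(Df,u,v)$, where $(Df)(u):=\rho(u)(f)$. An $E$-connection on a vector bundle $R$ over $M$ is an $\mathbb{R}$-bilinear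 map $\nabla:\mathfrak{X}(E)\times\Gamma(R)\to\Gamma(R)$ with $\nabla_v(fr)=\rho(v)(f)r+f\nabla_vr$ and $\nabla_{fv}r=f\nabla_vr$; it is equivalently a map $\Gamma(R)\to\Gamma(E^*\otimes R)$, $r\mapsto\nabla r$. A linear $E$-connection is an $E$-connection on $E$ itself. A conformal Courant algebroid is a sextet $(E,\rho,[\cdot,\cdot]_E,R,g,{}^R\nabla)$ where $(E,\rho,[\cdot,\cdot]_E)$ is a Leibniz algebroid over $M$, $R$ is a line bundle over $M$, $g$ is an $R$-valued $E$-metric (fiberwise symmetric, bilinear, non-degenerate $E\times E\to R$), and ${}^R\nabla$ is an $E$-connection on $R$ satisfying, for all $u,v,w$: ${}^R\nabla_u(g(v,w))=g([u,v]_E,w)+g(v,[u,w]_E)$ and $[u,v]_E+[v,u]_E=g^{-1}({}^R\nabla(g(u,v)))$. Here $g^{-1}:R\otimes E^*\to E$ is the inverse of $u\mapsto g(u,\cdot)$. $(X_a)$ denotes a local frame of $E$, $(e^a)$ the dual coframe, repeated indices are summed. $\nabla$ is admissible (with respect to $L$) if $[u,v]_E+[v,u]_E=L(e^a,\nabla_{X_a}u,v)+L(e^a,\nabla_{X_a}v,u)$ for all $u,v\in\mathfrak{X}(E)$. *)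

theory Defs
  imports "HOL-Analysis.Analysis"
begin

section \<open>Smooth maps on subsets of Euclidean spaces\<close>

primrec ktimes_differentiable_on ::
  "nat \<Rightarrow> 'a::real_normed_vector set \<Rightarrow> ('a \<Rightarrow> 'b::real_normed_vector) \<Rightarrow> bool" where
  "ktimes_differentiable_on 0 S f \<longleftrightarrow> continuous_on S f"
| "ktimes_differentiable_on (Suc n) S f \<longleftrightarrow>
     (\<forall>x\<in>S. f differentiable (at x)) \<and>
     (\<forall>v. ktimes_differentiable_on n S (\<lambda>x. frechet_derivative f (at x) v))"

text \<open>For open \<open>S\<close> this is the usual notion; for an arbitrary subset, smoothness means that
  there are local smooth extensions to open sets of the ambient space.\<close>

definition C_infinity_on ::
  "'a::real_normed_vector set \<Rightarrow> ('a \<Rightarrow> 'b::real_normed_vector) \<Rightarrow> bool" where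
  "C_infinity_on S f \<longleftrightarrow>
     (\<forall>x\<in>S. \<exists>W g. open W \<and> x \<in> W \<and> (\<forall>n. ktimes_differentiable_on n W g) \<and>
                  (\<forall>y\<in>W \<inter> S. g y = f y))"


section \<open>Smooth manifolds\<close>

text \<open>The underlying set is the whole type \<open>'m\<close>; Hausdorffness and second countability are
  sort constraints. Charts take values in a linear subspace \<open>model\<close> of a Euclidean
  space (rather than in the Euclidean space itself, whose dimension is never \<open>0\<close>), so that
  manifolds of every dimension, including \<open>0\<close>, are covered. The atlas need not be maximal.\<close>

record ('m, 'b) manifold =
  model :: "'b set"
  atlas :: "('m set \<times> ('m \<Rightarrow> 'b)) set"

definition smooth_manifold ::
  "('m::{t2_space,second_countable_topology}, 'b::euclidean_space) manifold \<Rightarrow> bool" where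
  "smooth_manifold M \<longleftrightarrow>
     subspace (model M) \<and>
     (\<forall>(U, \<phi>)\<in>atlas M. open U \<and> \<phi> ` U \<subseteq> model M \<and>
        openin (top_of_set (model M)) (\<phi> ` U) \<and>
        homeomorphism U (\<phi> ` U) \<phi> (inv_into U \<phi>)) \<and>
     (\<Union>(U, \<phi>)\<in>atlas M. U) = UNIV \<and>
     (\<forall>(U, \<phi>)\<in>atlas M. \<forall>(U', \<phi>')\<in>atlas M.
        C_infinity_on (\<phi> ` (U \<inter> U')) (\<phi>' \<circ> inv_into U \<phi>))"

text \<open>Smoothness of a function on an open subset \<open>W\<close> of the manifold.\<close>

definition smooth_fun_on ::
  "('m, 'b::euclidean_space) manifold \<Rightarrow> 'm set \<Rightarrow> ('m \<Rightarrow> real) \<Rightarrow> bool" where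
  "smooth_fun_on M W f \<longleftrightarrow>
     (\<forall>(U, \<phi>)\<in>atlas M. C_infinity_on (\<phi> ` (U \<inter> W)) (f \<circ> inv_into U \<phi>))"

definition smooth_funs :: "('m, 'b::euclidean_space) manifold \<Rightarrow> ('m \<Rightarrow> real) set" where
  "smooth_funs M = {f. smooth_fun_on M UNIV f}"

text \<open>Tangent vectors are derivations of the algebra of smooth functions at a point. The last
  clause only makes a derivation, as a total function, unique.\<close>

definition tangent_space ::
  "('m, 'b::euclidean_space) manifold \<Rightarrow> 'm \<Rightarrow> (('m \<Rightarrow> real) \<Rightarrow> real) set" where
  "tangent_space M p =
     {X. (\<forall>f\<in>smooth_funs M. \<forall>h\<in>smooth_funs M. \<forall>c d.
            X (\<lambda>q. c * f q + d * h q) = c * X f + d * X h) \<and>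
         (\<forall>f\<in>smooth_funs M. \<forall>h\<in>smooth_funs M.
            X (\<lambda>q. f q * h q) = f p * X h + h p * X f) \<and>
         (\<forall>f. f \<notin> smooth_funs M \<longrightarrow> X f = 0)}"

definition smooth_vector_field_on ::
  "('m, 'b::euclidean_space) manifold \<Rightarrow> 'm set \<Rightarrow> ('m \<Rightarrow> ('m \<Rightarrow> real) \<Rightarrow> real) \<Rightarrow> bool" where
  "smooth_vector_field_on M W X \<longleftrightarrow>
     (\<forall>p\<in>W. X p \<in> tangent_space M p) \<and>
     (\<forall>f\<in>smooth_funs M. smooth_fun_on M W (\<lambda>p. X p f))"


section \<open>Vector bundles of constant rank\<close>

text \<open>The fibres are linear subspaces of a real vector space \<open>'e\<close>, which carries no
  topology and serves only to provide the fibrewise operations. The smooth structure is given by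
  a covering family of local frames (equivalently, local trivialisations) with smooth transition
  functions. A frame \<open>(U, s)\<close> consists of \<open>s 0, \<dots>, s (rank - 1)\<close>.\<close>

record ('m, 'e) vbundle =
  rank :: nat
  fibre :: "'m \<Rightarrow> 'e set"
  frames :: "('m set \<times> (nat \<Rightarrow> 'm \<Rightarrow> 'e)) set"

definition fibre_basis :: "('m, 'e::real_vector) vbundle \<Rightarrow> 'm \<Rightarrow> (nat \<Rightarrow> 'm \<Rightarrow> 'e) \<Rightarrow> bool" where
  "fibre_basis E p s \<longleftrightarrow>
     inj_on (\<lambda>a. s a p) {..<rank E} \<and>
     independent ((\<lambda>a. s a p) ` {..<rank E}) \<and>
     span ((\<lambda>a. s a p) ` {..<rank E}) = fibre E p"

text \<open>A section over an open set is smooth if its coefficients in each frame of the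
  bundle are.\<close>

definition smooth_section_on ::
  "('m, 'b::euclidean_space) manifold \<Rightarrow> ('m, 'e::real_vector) vbundle \<Rightarrow> 'm set \<Rightarrow>
     ('m \<Rightarrow> 'e) \<Rightarrow> bool" where
  "smooth_section_on M E W u \<longleftrightarrow>
     (\<forall>p\<in>W. u p \<in> fibre E p) \<and>
     (\<forall>(U, s)\<in>frames E. \<exists>c.
        (\<forall>a<rank E. smooth_fun_on M (U \<inter> W) (c a)) \<and>
        (\<forall>p\<in>U \<inter> W. u p = (\<Sum>a<rank E. c a p *\<^sub>R s a p)))"

definition vector_bundle ::
  "('m::topological_space, 'b::euclidean_space) manifold \<Rightarrow> ('m, 'e::real_vector) vbundle \<Rightarrow> bool" where
  "vector_bundle M E \<longleftrightarrow>
     (\<forall>(U, s)\<in>frames E. open U \<and> (\<forall>p\<in>U. fibre_basis E p s) \<and>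
        (\<forall>a<rank E. smooth_section_on M E U (s a))) \<and>
     (\<Union>(U, s)\<in>frames E. U) = UNIV"

definition line_bundle ::
  "('m::topological_space, 'b::euclidean_space) manifold \<Rightarrow> ('m, 'e::real_vector) vbundle \<Rightarrow> bool" where
  "line_bundle M R \<longleftrightarrow> vector_bundle M R \<and> rank R = 1"

definition sections ::
  "('m, 'b::euclidean_space) manifold \<Rightarrow> ('m, 'e::real_vector) vbundle \<Rightarrow> ('m \<Rightarrow> 'e) set" where
  "sections M E = {u. smooth_section_on M E UNIV u}"

definition linear_between ::
  "'a::real_vector set \<Rightarrow> 'b::real_vector set \<Rightarrow> ('a \<Rightarrow> 'b) \<Rightarrow> bool" where
  "linear_between V W \<phi> \<longleftrightarrow>
     (\<forall>x\<in>V. \<phi> x \<in> W) \<and>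
     (\<forall>x\<in>V. \<forall>y\<in>V. \<forall>c d. \<phi> (c *\<^sub>R x + d *\<^sub>R y) = c *\<^sub>R \<phi> x + d *\<^sub>R \<phi> y)"

text \<open>Smooth sections of the dual bundle. Only the values of \<open>\<Omega> p\<close> on the fibre over
  \<open>p\<close> are relevant.\<close>

definition one_forms ::
  "('m::topological_space, 'b::euclidean_space) manifold \<Rightarrow> ('m, 'e::real_vector) vbundle \<Rightarrow>
     ('m \<Rightarrow> 'e \<Rightarrow> real) set" where
  "one_forms M E =
     {\<Omega>. (\<forall>p. linear_between (fibre E p) UNIV (\<Omega> p)) \<and>
         (\<forall>W u. open W \<longrightarrow> smooth_section_on M E W u \<longrightarrow> smooth_fun_on M W (\<lambda>p. \<Omega> p (u p)))}"

definition local_frame ::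
  "('m::topological_space, 'b::euclidean_space) manifold \<Rightarrow> ('m, 'e::real_vector) vbundle \<Rightarrow>
     'm set \<Rightarrow> (nat \<Rightarrow> 'm \<Rightarrow> 'e) \<Rightarrow> bool" where
  "local_frame M E U X \<longleftrightarrow>
     open U \<and> (\<forall>a<rank E. smooth_section_on M E U (X a)) \<and> (\<forall>p\<in>U. fibre_basis E p X)"

text \<open>The dual coframe: \<open>dual_coframe E X a p e\<close> is the coefficient of \<open>X a p\<close> in the
  expansion of \<open>e\<close> in the basis \<open>X 0 p, X 1 p, \<dots>\<close>.\<close>

definition dual_coframe ::
  "('m, 'e::real_vector) vbundle \<Rightarrow> (nat \<Rightarrow> 'm \<Rightarrow> 'e) \<Rightarrow> nat \<Rightarrow> 'm \<Rightarrow> 'e \<Rightarrow> real" where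
  "dual_coframe E X a p e = representation ((\<lambda>b. X b p) ` {..<rank E}) e (X a p)"

text \<open>Some global section (or one-form) with a prescribed value at \<open>p\<close>. They are used to
  evaluate \<open>C\<^sup>\<infinity>(M)\<close>-linear operations, which are pointwise in the respective argument,
  on local sections and on elements of fibres.\<close>

definition section_through ::
  "('m, 'b::euclidean_space) manifold \<Rightarrow> ('m, 'e::real_vector) vbundle \<Rightarrow> 'm \<Rightarrow> 'e \<Rightarrow> ('m \<Rightarrow> 'e)" where
  "section_through M E p e = (SOME u. u \<in> sections M E \<and> u p = e)"

definition one_form_through ::
  "('m::topological_space, 'b::euclidean_space) manifold \<Rightarrow> ('m, 'e::real_vector) vbundle \<Rightarrow>
     'm \<Rightarrow> ('e \<Rightarrow> real) \<Rightarrow> ('m \<Rightarrow> 'e \<Rightarrow> real)" where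
  "one_form_through M E p \<omega> = (SOME \<Omega>. \<Omega> \<in> one_forms M E \<and> (\<forall>e\<in>fibre E p. \<Omega> p e = \<omega> e))"


section \<open>Leibniz algebroids and connections\<close>

definition anchored_bundle ::
  "('m::topological_space, 'b::euclidean_space) manifold \<Rightarrow> ('m, 'e::real_vector) vbundle \<Rightarrow>
     ('m \<Rightarrow> 'e \<Rightarrow> ('m \<Rightarrow> real) \<Rightarrow> real) \<Rightarrow> bool" where
  "anchored_bundle M E \<rho> \<longleftrightarrow>
     vector_bundle M E \<and>
     (\<forall>p. \<forall>e\<in>fibre E p. \<rho> p e \<in> tangent_space M p) \<and>
     (\<forall>p f. linear_between (fibre E p) UNIV (\<lambda>e. \<rho> p e f)) \<and>
     (\<forall>W u. open W \<longrightarrow> smooth_section_on M E W u \<longrightarrow>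
        smooth_vector_field_on M W (\<lambda>p. \<rho> p (u p)))"

text \<open>\<open>\<real>\<close>-bilinearity of an operation on sections.\<close>

definition real_bilinear_sections ::
  "('m \<Rightarrow> 'e::real_vector) set \<Rightarrow> ('m \<Rightarrow> 'r::real_vector) set \<Rightarrow> ('m \<Rightarrow> 's::real_vector) set \<Rightarrow>
     (('m \<Rightarrow> 'e) \<Rightarrow> ('m \<Rightarrow> 'r) \<Rightarrow> ('m \<Rightarrow> 's)) \<Rightarrow> bool" where
  "real_bilinear_sections A B C F \<longleftrightarrow>
     (\<forall>u\<in>A. \<forall>r\<in>B. F u r \<in> C) \<and>
     (\<forall>u\<in>A. \<forall>v\<in>A. \<forall>r\<in>B. \<forall>c d.
        F (\<lambda>p. c *\<^sub>R u p + d *\<^sub>R v p) r = (\<lambda>p. c *\<^sub>R F u r p + d *\<^sub>R F v r p)) \<and>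
     (\<forall>u\<in>A. \<forall>r\<in>B. \<forall>s\<in>B. \<forall>c d.
        F u (\<lambda>p. c *\<^sub>R r p + d *\<^sub>R s p) = (\<lambda>p. c *\<^sub>R F u r p + d *\<^sub>R F u s p))"

definition almost_Leibniz_algebroid ::
  "('m::topological_space, 'b::euclidean_space) manifold \<Rightarrow> ('m, 'e::real_vector) vbundle \<Rightarrow>
     ('m \<Rightarrow> 'e \<Rightarrow> ('m \<Rightarrow> real) \<Rightarrow> real) \<Rightarrow> (('m \<Rightarrow> 'e) \<Rightarrow> ('m \<Rightarrow> 'e) \<Rightarrow> ('m \<Rightarrow> 'e)) \<Rightarrow> bool" where
  "almost_Leibniz_algebroid M E \<rho> br \<longleftrightarrow>
     anchored_bundle M E \<rho> \<and>
     real_bilinear_sections (sections M E) (sections M E) (sections M E) br \<and>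
     (\<forall>u\<in>sections M E. \<forall>v\<in>sections M E. \<forall>f\<in>smooth_funs M.
        br u (\<lambda>p. f p *\<^sub>R v p) = (\<lambda>p. \<rho> p (u p) f *\<^sub>R v p + f p *\<^sub>R br u v p))"

definition Leibniz_algebroid ::
  "('m::topological_space, 'b::euclidean_space) manifold \<Rightarrow> ('m, 'e::real_vector) vbundle \<Rightarrow>
     ('m \<Rightarrow> 'e \<Rightarrow> ('m \<Rightarrow> real) \<Rightarrow> real) \<Rightarrow> (('m \<Rightarrow> 'e) \<Rightarrow> ('m \<Rightarrow> 'e) \<Rightarrow> ('m \<Rightarrow> 'e)) \<Rightarrow> bool" where
  "Leibniz_algebroid M E \<rho> br \<longleftrightarrow>
     almost_Leibniz_algebroid M E \<rho> br \<and>
     (\<forall>u\<in>sections M E. \<forall>v\<in>sections M E. \<forall>w\<in>sections M E.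
        br u (br v w) = (\<lambda>p. br (br u v) w p + br v (br u w) p))"

definition E_connection ::
  "('m::topological_space, 'b::euclidean_space) manifold \<Rightarrow> ('m, 'e::real_vector) vbundle \<Rightarrow>
     ('m \<Rightarrow> 'e \<Rightarrow> ('m \<Rightarrow> real) \<Rightarrow> real) \<Rightarrow> ('m, 'r::real_vector) vbundle \<Rightarrow>
     (('m \<Rightarrow> 'e) \<Rightarrow> ('m \<Rightarrow> 'r) \<Rightarrow> ('m \<Rightarrow> 'r)) \<Rightarrow> bool" where
  "E_connection M E \<rho> R D \<longleftrightarrow>
     real_bilinear_sections (sections M E) (sections M R) (sections M R) D \<and>
     (\<forall>v\<in>sections M E. \<forall>r\<in>sections M R. \<forall>f\<in>smooth_funs M.
        D v (\<lambda>p. f p *\<^sub>R r p) = (\<lambda>p. \<rho> p (v p) f *\<^sub>R r p + f p *\<^sub>R D v r p) \<and>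
        D (\<lambda>p. f p *\<^sub>R v p) r = (\<lambda>p. f p *\<^sub>R D v r p))"

definition linear_E_connection ::
  "('m::topological_space, 'b::euclidean_space) manifold \<Rightarrow> ('m, 'e::real_vector) vbundle \<Rightarrow>
     ('m \<Rightarrow> 'e \<Rightarrow> ('m \<Rightarrow> real) \<Rightarrow> real) \<Rightarrow> (('m \<Rightarrow> 'e) \<Rightarrow> ('m \<Rightarrow> 'e) \<Rightarrow> ('m \<Rightarrow> 'e)) \<Rightarrow> bool" where
  "linear_E_connection M E \<rho> nabla \<longleftrightarrow> E_connection M E \<rho> E nabla"

text \<open>The section \<open>\<nabla>r\<close> of \<open>E\<^sup>* \<otimes> R\<close> defined by an \<open>E\<close>-connection; elements of
  the fibre of \<open>E\<^sup>* \<otimes> R\<close> over \<open>p\<close> are linear maps from the fibre of \<open>E\<close> to that of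
  \<open>R\<close>. The choice made by \<open>section_through\<close> is immaterial, as \<open>\<nabla>\<close> is
  \<open>C\<^sup>\<infinity>(M)\<close>-linear in its first argument.\<close>

definition covariant_differential ::
  "('m, 'b::euclidean_space) manifold \<Rightarrow> ('m, 'e::real_vector) vbundle \<Rightarrow>
     (('m \<Rightarrow> 'e) \<Rightarrow> ('m \<Rightarrow> 'r) \<Rightarrow> ('m \<Rightarrow> 'r)) \<Rightarrow> ('m \<Rightarrow> 'r) \<Rightarrow> 'm \<Rightarrow> 'e \<Rightarrow> 'r::real_vector" where
  "covariant_differential M E D r p e = D (section_through M E p e) r p"


section \<open>Conformal Courant algebroids\<close>

definition E_metric ::
  "('m::topological_space, 'b::euclidean_space) manifold \<Rightarrow> ('m, 'e::real_vector) vbundle \<Rightarrow>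
     ('m, 'r::real_vector) vbundle \<Rightarrow> ('m \<Rightarrow> 'e \<Rightarrow> 'e \<Rightarrow> 'r) \<Rightarrow> bool" where
  "E_metric M E R g \<longleftrightarrow>
     (\<forall>p. \<forall>e\<in>fibre E p. linear_between (fibre E p) (fibre R p) (g p e)) \<and>
     (\<forall>p. \<forall>e\<in>fibre E p. \<forall>e'\<in>fibre E p. g p e e' = g p e' e) \<and>
     (\<forall>p. \<forall>e\<in>fibre E p. (\<forall>e'\<in>fibre E p. g p e e' = 0) \<longrightarrow> e = 0) \<and>
     (\<forall>W u v. open W \<longrightarrow> smooth_section_on M E W u \<longrightarrow> smooth_section_on M E W v \<longrightarrow>
        smooth_section_on M R W (\<lambda>p. g p (u p) (v p)))"

text \<open>The inverse of \<open>u \<mapsto> g(u,\<cdot>)\<close> on the fibre over \<open>p\<close>. Since \<open>R\<close> is a line bundle,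
  \<open>E\<close> and \<open>R \<otimes> E\<^sup>*\<close> have the same rank, so \<open>g_inv E g p \<alpha>\<close> is well-defined for
  every linear map \<open>\<alpha>\<close> from the fibre of \<open>E\<close> to the fibre of \<open>R\<close>.\<close>

definition g_inv ::
  "('m, 'e::real_vector) vbundle \<Rightarrow> ('m \<Rightarrow> 'e \<Rightarrow> 'e \<Rightarrow> 'r::real_vector) \<Rightarrow> 'm \<Rightarrow> ('e \<Rightarrow> 'r) \<Rightarrow> 'e" where
  "g_inv E g p \<alpha> = (THE u. u \<in> fibre E p \<and> (\<forall>w\<in>fibre E p. g p u w = \<alpha> w))"

definition conformal_Courant_algebroid ::
  "('m::topological_space, 'b::euclidean_space) manifold \<Rightarrow> ('m, 'e::real_vector) vbundle \<Rightarrow>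
     ('m \<Rightarrow> 'e \<Rightarrow> ('m \<Rightarrow> real) \<Rightarrow> real) \<Rightarrow> (('m \<Rightarrow> 'e) \<Rightarrow> ('m \<Rightarrow> 'e) \<Rightarrow> ('m \<Rightarrow> 'e)) \<Rightarrow>
     ('m, 'r::real_vector) vbundle \<Rightarrow> ('m \<Rightarrow> 'e \<Rightarrow> 'e \<Rightarrow> 'r) \<Rightarrow>
     (('m \<Rightarrow> 'e) \<Rightarrow> ('m \<Rightarrow> 'r) \<Rightarrow> ('m \<Rightarrow> 'r)) \<Rightarrow> bool" where
  "conformal_Courant_algebroid M E \<rho> br R g D \<longleftrightarrow>
     Leibniz_algebroid M E \<rho> br \<and>
     line_bundle M R \<and>
     E_metric M E R g \<and>
     E_connection M E \<rho> R D \<and>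
     (\<forall>u\<in>sections M E. \<forall>v\<in>sections M E. \<forall>w\<in>sections M E. \<forall>p.
        D u (\<lambda>q. g q (v q) (w q)) p = g p (br u v p) (w p) + g p (v p) (br u w p)) \<and>
     (\<forall>u\<in>sections M E. \<forall>v\<in>sections M E. \<forall>p.
        br u v p + br v u p =
          g_inv E g p (covariant_differential M E D (\<lambda>q. g q (u q) (v q)) p))"

text \<open>The locality operator \<open>(\<Omega>, u, v) \<mapsto> g\<^sup>-\<^sup>1(g(u,v) \<otimes> \<Omega>)\<close>.\<close>

definition RL ::
  "('m, 'e::real_vector) vbundle \<Rightarrow> ('m \<Rightarrow> 'e \<Rightarrow> 'e \<Rightarrow> 'r::real_vector) \<Rightarrow>
     ('m \<Rightarrow> 'e \<Rightarrow> real) \<Rightarrow> ('m \<Rightarrow> 'e) \<Rightarrow> ('m \<Rightarrow> 'e) \<Rightarrow> ('m \<Rightarrow> 'e)" where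
  "RL E g \<Omega> u v = (\<lambda>p. g_inv E g p (\<lambda>w. \<Omega> p w *\<^sub>R g p (u p) (v p)))"


section \<open>Admissible and metric-compatible connections\<close>

text \<open>The value at \<open>p\<close> of the \<open>C\<^sup>\<infinity>(M)\<close>-multilinear operator \<open>L\<close> on a covector and
  two elements of the fibre over \<open>p\<close>.\<close>

definition locality_operator_at ::
  "('m::topological_space, 'b::euclidean_space) manifold \<Rightarrow> ('m, 'e::real_vector) vbundle \<Rightarrow>
     (('m \<Rightarrow> 'e \<Rightarrow> real) \<Rightarrow> ('m \<Rightarrow> 'e) \<Rightarrow> ('m \<Rightarrow> 'e) \<Rightarrow> ('m \<Rightarrow> 'e)) \<Rightarrow>
     'm \<Rightarrow> ('e \<Rightarrow> real) \<Rightarrow> 'e \<Rightarrow> 'e \<Rightarrow> 'e" where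
  "locality_operator_at M E L p \<omega> x y =
     L (one_form_through M E p \<omega>) (section_through M E p x) (section_through M E p y) p"

text \<open>The frame \<open>X\<close> is only local, whereas \<open>\<nabla>\<close> and \<open>L\<close> act on global sections; hence
  \<open>\<nabla>\<^bsub>X\<^sub>a\<^esub> u\<close> at \<open>p\<close> is \<open>(\<nabla>u)(p)\<close> contracted with \<open>X a p\<close>.\<close>

definition admissible ::
  "('m::topological_space, 'b::euclidean_space) manifold \<Rightarrow> ('m, 'e::real_vector) vbundle \<Rightarrow>
     (('m \<Rightarrow> 'e) \<Rightarrow> ('m \<Rightarrow> 'e) \<Rightarrow> ('m \<Rightarrow> 'e)) \<Rightarrow>
     (('m \<Rightarrow> 'e \<Rightarrow> real) \<Rightarrow> ('m \<Rightarrow> 'e) \<Rightarrow> ('m \<Rightarrow> 'e) \<Rightarrow> ('m \<Rightarrow> 'e)) \<Rightarrow>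
     (('m \<Rightarrow> 'e) \<Rightarrow> ('m \<Rightarrow> 'e) \<Rightarrow> ('m \<Rightarrow> 'e)) \<Rightarrow> bool" where
  "admissible M E br L nabla \<longleftrightarrow>
     (\<forall>u\<in>sections M E. \<forall>v\<in>sections M E. \<forall>U X. local_frame M E U X \<longrightarrow> (\<forall>p\<in>U.
        br u v p + br v u p =
          (\<Sum>a<rank E.
             locality_operator_at M E L p (dual_coframe E X a p)
               (covariant_differential M E nabla u p (X a p)) (v p) +
             locality_operator_at M E L p (dual_coframe E X a p)
               (covariant_differential M E nabla v p (X a p)) (u p))))"

definition metric_compatible ::
  "('m, 'b::euclidean_space) manifold \<Rightarrow> ('m, 'e::real_vector) vbundle \<Rightarrow>
     ('m \<Rightarrow> 'e \<Rightarrow> 'e \<Rightarrow> 'r::real_vector) \<Rightarrow> (('m \<Rightarrow> 'e) \<Rightarrow> ('m \<Rightarrow> 'r) \<Rightarrow> ('m \<Rightarrow> 'r)) \<Rightarrow>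
     (('m \<Rightarrow> 'e) \<Rightarrow> ('m \<Rightarrow> 'e) \<Rightarrow> ('m \<Rightarrow> 'e)) \<Rightarrow> bool" where
  "metric_compatible M E g D nabla \<longleftrightarrow>
     (\<forall>u\<in>sections M E. \<forall>v\<in>sections M E. \<forall>w\<in>sections M E. \<forall>p.
        D u (\<lambda>q. g q (v q) (w q)) p = g p (nabla u v p) (w p) + g p (v p) (nabla u w p))"

end

theory Submission
  imports Defs
begin

text \<open>Both conditions concern the pairing of a section with an arbitrary vector \<open>w\<close> at a point
  \<open>p\<close>. Pairing the symmetric part of the bracket with \<open>w\<close> gives \<open>D\<^bsub>w\<^esub>(g(u,v))\<close>, while pairing
  \<open>L(e\<^sup>a, \<nabla>\<^bsub>X\<^sub>a\<^esub> u, v)\<close> with \<open>w\<close> and summing over \<open>a\<close> gives \<open>g(\<nabla>\<^bsub>w\<^esub> u, v)\<close>. Hence by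
  non-degeneracy of \<open>g\<close> admissibility says exactly that \<open>\<nabla>\<close> is compatible with \<open>g\<close>. To make sense of
  \<open>D\<^bsub>w\<^esub>\<close> and \<open>\<nabla>\<^bsub>w\<^esub>\<close> one needs bump functions: they provide global sections and one-forms with
  prescribed values at \<open>p\<close>, and show that \<open>C\<^sup>\<infinity>(M)\<close>-linear operations are pointwise.\<close>

section \<open>Smooth maps on Euclidean spaces\<close>

text \<open>Two obstacles shape the argument. The sections and one-forms behind
  \<open>covariant_differential\<close> and \<open>locality_operator_at\<close> are picked by
  \<open>SOME\<close>, so nothing can be computed before a global object with the prescribed value
  is known to exist and the choice is known not to matter. Likewise \<open>g_inv\<close> is a
  definite description: its defining property rests on surjectivity of u -> g(u,.), which holds
  because the fibres of \<open>R\<close> are lines, so that source and target have equal dimension.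
  The two conditions also quantify over different data. In admissibility the two sections are the
  arguments of the metric and the direction of differentiation is hidden in the test vector;
  compatibility names the direction as a third section. Restating both over the fibre at p
  reconciles them and gives an equivalence for each single pair of sections, point and
  frame.\<close>

lemma ktimes_differentiable_on_subset:
  "ktimes_differentiable_on n S f \<Longrightarrow> T \<subseteq> S \<Longrightarrow> ktimes_differentiable_on n T f"
  by (induction n arbitrary: f) (auto intro: continuous_on_subset)

text \<open>Openness of \<open>S\<close> turns equality on \<open>S\<close> into equality near each
  of its points, so the derivatives agree on \<open>S\<close> too and the induction descends to
  them.\<close>

lemma ktimes_differentiable_on_cong:
  assumes "open S" "\<And>x. x \<in> S \<Longrightarrow> f x = g x" "ktimes_differentiable_on n S f"
  shows "ktimes_differentiable_on n S g"
  using assms(2,3)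
proof (induction n arbitrary: f g)
  case 0
  then show ?case by (simp cong: continuous_on_cong)
next
  case (Suc n)
  have der: "(g has_derivative frechet_derivative f (at x)) (at x)" if "x \<in> S" for x
  proof (rule has_derivative_transform_within_open[OF _ assms(1) that])
    show "(f has_derivative frechet_derivative f (at x)) (at x)"
      using Suc.prems(2) that by (intro frechet_derivative_works[THEN iffD1]) simp
  qed (use Suc.prems(1) in simp)
  have "frechet_derivative g (at x) = frechet_derivative f (at x)" if "x \<in> S" for x
    using frechet_derivative_at[OF der[OF that]] by simp
  then have "ktimes_differentiable_on n S (\<lambda>x. frechet_derivative g (at x) v)" for v
    using Suc.prems(2) by (intro Suc.IH[of "\<lambda>x. frechet_derivative f (at x) v" "\<lambda>x. frechet_derivative g (at x) v", OF _ Suc.prems(2)[THEN ktimes_differentiable_on.simps(2)[THEN iffD1], THEN conjunct2, THEN spec]]) simp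
  then show ?case
    using der by (auto simp: differentiable_def)
qed

text \<open>Derivatives are unique, so any explicit formula \<open>f'\<close> may replace the chosen
  \<open>frechet_derivative\<close>; all later inductions on the order step through this
  rule.\<close>

lemma ktimes_differentiable_on_SucI:
  assumes "open S" "\<And>x. x \<in> S \<Longrightarrow> (f has_derivative f' x) (at x)"
    and "\<And>v. ktimes_differentiable_on n S (\<lambda>x. f' x v)"
  shows "ktimes_differentiable_on (Suc n) S f"
proof -
  have "frechet_derivative f (at x) = f' x" if "x \<in> S" for x
    using frechet_derivative_at[OF assms(2)[OF that]] by simp
  then have "ktimes_differentiable_on n S (\<lambda>x. frechet_derivative f (at x) v)" for v
    by (intro ktimes_differentiable_on_cong[OF assms(1) _ assms(3)[of v]]) simp
  then show ?thesis
    using assms(2) by (auto simp: differentiable_def)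
qed

text \<open>Order n + 1 does not contain order n by definition; the claim comes down to the base
  case, where differentiability implies continuity.\<close>

lemma ktimes_differentiable_on_SucD:
  "ktimes_differentiable_on (Suc n) S f \<Longrightarrow> ktimes_differentiable_on n S f"
proof (induction n arbitrary: f)
  case 0
  then show ?case
    by (auto intro!: continuous_at_imp_continuous_on differentiable_imp_continuous_within)
next
  case (Suc n)
  have "ktimes_differentiable_on n S (\<lambda>x. frechet_derivative f (at x) v)" for v
    using Suc.prems by (intro Suc.IH) (simp only: ktimes_differentiable_on.simps(2)[of "Suc n"])
  then show ?case using Suc.prems by simp
qed

lemma ktimes_differentiable_on_const:
  "open S \<Longrightarrow> ktimes_differentiable_on n S (\<lambda>x. c)"
proof (induction n arbitrary: c)
  case (Suc n)
  show ?case
    by (rule ktimes_differentiable_on_SucI[where f' = "\<lambda>x v. 0"]) (use Suc in auto)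
qed simp

lemma has_derivative_frechet_derivative:
  "ktimes_differentiable_on (Suc n) S f \<Longrightarrow> x \<in> S \<Longrightarrow>
    (f has_derivative frechet_derivative f (at x)) (at x)"
  by (intro frechet_derivative_works[THEN iffD1]) simp

lemma ktimes_differentiable_on_add:
  assumes "open S"
  shows "ktimes_differentiable_on n S f \<Longrightarrow> ktimes_differentiable_on n S g \<Longrightarrow>
    ktimes_differentiable_on n S (\<lambda>x. f x + g x)"
proof (induction n arbitrary: f g)
  case 0
  then show ?case by (simp add: continuous_on_add)
next
  case (Suc n)
  note der = Suc.prems[THEN has_derivative_frechet_derivative]
  show ?case
  proof (rule ktimes_differentiable_on_SucI[OF assms has_derivative_add[OF der]])
    show "ktimes_differentiable_on n S
        (\<lambda>x. frechet_derivative f (at x) v + frechet_derivative g (at x) v)" for v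
      using Suc.prems by (intro Suc.IH) auto
  qed
qed

text \<open>The product rule leaves one factor undifferentiated in each term, which is why the
  factors are also needed at the lower order. Stated for bounded bilinear maps, it serves both
  multiplication and the inner product.\<close>

lemma (in bounded_bilinear) ktimes_differentiable_on:
  assumes "open S"
  shows "ktimes_differentiable_on n S f \<Longrightarrow> ktimes_differentiable_on n S g \<Longrightarrow>
    ktimes_differentiable_on n S (\<lambda>x. prod (f x) (g x))"
proof (induction n arbitrary: f g)
  case 0
  then show ?case by (simp add: continuous_on)
next
  case (Suc n)
  note lower = Suc.prems[THEN ktimes_differentiable_on_SucD]
  note der = Suc.prems[THEN has_derivative_frechet_derivative]
  show ?case
  proof (rule ktimes_differentiable_on_SucI[OF assms FDERIV[OF der]])
    fix v
    show "ktimes_differentiable_on n S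
        (\<lambda>x. prod (f x) (frechet_derivative g (at x) v) + prod (frechet_derivative f (at x) v) (g x))"
      using Suc.prems lower by (intro ktimes_differentiable_on_add assms Suc.IH) auto
  qed
qed

text \<open>The family is closed under differentiation up to linear combinations, so that smoothness of
  all its members follows by a single induction; \<open>k = 0\<close> is the usual flat function.\<close>

definition flat_exp :: "nat \<Rightarrow> real \<Rightarrow> real" where
  "flat_exp k t = (if t > 0 then exp (- inverse t) * inverse t ^ k else 0)"

lemma has_real_derivative_flat_exp:
  "(flat_exp k has_real_derivative flat_exp (k + 2) t - of_nat k * flat_exp (k + 1) t) (at t)"
proof -
  consider "t > 0" | "t < 0" | "t = 0" by linarith
  then show ?thesis
  proof cases
    case 1
    have "((\<lambda>t. exp (- inverse t) * inverse t ^ k) has_real_derivative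
        exp (- inverse t) * inverse t ^ 2 * inverse t ^ k -
        exp (- inverse t) * (of_nat k * inverse t ^ (k - 1) * inverse t ^ 2)) (at t)"
      using 1 by (auto intro!: derivative_eq_intros simp: power2_eq_square)
    also have "exp (- inverse t) * inverse t ^ 2 * inverse t ^ k -
        exp (- inverse t) * (of_nat k * inverse t ^ (k - 1) * inverse t ^ 2) =
        flat_exp (k + 2) t - of_nat k * flat_exp (k + 1) t"
      \<comment> \<open>\<open>k - 1\<close> is truncated subtraction: for \<open>k = 0\<close> the
        factor \<open>of_nat k\<close> removes the term, otherwise the exponents add up to
        \<open>k + 1\<close>.\<close>
      using 1 by (cases k) (auto simp: flat_exp_def power2_eq_square)
    finally have "((\<lambda>t. exp (- inverse t) * inverse t ^ k) has_real_derivative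
        flat_exp (k + 2) t - of_nat k * flat_exp (k + 1) t) (at t)" .
    then show ?thesis
      by (rule has_field_derivative_transform_within_open[where S = "{0<..}"])
        (use 1 in \<open>auto simp: flat_exp_def\<close>)
  next
    case 2
    have "((\<lambda>t. 0) has_real_derivative 0) (at t)" by simp
    then have "(flat_exp k has_real_derivative 0) (at t)"
      by (rule has_field_derivative_transform_within_open[where S = "{..<0}"])
        (use 2 in \<open>auto simp: flat_exp_def\<close>)
    with 2 show ?thesis by (simp add: flat_exp_def)
  next
    case 3
    \<comment> \<open>For h > 0 and s = 1/h the difference quotient at 0 is s^(k+1) / exp s, which
      tends to 0 as s grows.\<close>
    have "((\<lambda>h. inverse h ^ Suc k / exp (inverse h)) \<longlongrightarrow> (0::real)) (at_right 0)"
      by (rule filterlim_compose[OF tendsto_power_div_exp_0 filterlim_inverse_at_top_right])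
    then have "((\<lambda>h. flat_exp k h / h) \<longlongrightarrow> 0) (at_right 0)"
      by (rule Lim_transform_eventually)
        (auto simp: flat_exp_def eventually_at_filter exp_minus field_simps)
    moreover have "((\<lambda>h. flat_exp k h / h) \<longlongrightarrow> 0) (at_left 0)"
      by (rule tendsto_eventually) (auto simp: flat_exp_def eventually_at_filter)
    ultimately have "((\<lambda>h. flat_exp k h / h) \<longlongrightarrow> 0) (at 0)"
      by (simp add: filterlim_split_at)
    with 3 show ?thesis by (simp add: DERIV_def flat_exp_def)
  qed
qed

lemma ktimes_differentiable_on_flat_exp:
  assumes "open S"
  shows "ktimes_differentiable_on n S f \<Longrightarrow> ktimes_differentiable_on n S (\<lambda>x. flat_exp k (f x))"
proof (induction n arbitrary: f k)
  case 0
  have "continuous_on UNIV (flat_exp k)"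
    using has_real_derivative_flat_exp by (metis DERIV_isCont continuous_at_imp_continuous_on)
  with 0 show ?case by (auto intro: continuous_on_compose2)
next
  case (Suc n)
  note f = ktimes_differentiable_on_SucD[OF Suc.prems]
  have "((\<lambda>x. flat_exp k (f x)) has_derivative
      (\<lambda>v. (flat_exp (k + 2) (f x) + - of_nat k * flat_exp (k + 1) (f x)) *
        frechet_derivative f (at x) v)) (at x)" if "x \<in> S" for x
    using has_derivative_compose[OF has_derivative_frechet_derivative[OF Suc.prems that]
        has_real_derivative_flat_exp[of k "f x", unfolded has_field_derivative_def]]
    by simp
  then show ?case
  proof (rule ktimes_differentiable_on_SucI[OF assms])
    show "ktimes_differentiable_on n S
        (\<lambda>x. (flat_exp (k + 2) (f x) + - of_nat k * flat_exp (k + 1) (f x)) *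
          frechet_derivative f (at x) v)" for v
      using Suc.prems
      by (intro bounded_bilinear.ktimes_differentiable_on[OF bounded_bilinear_mult]
        ktimes_differentiable_on_add ktimes_differentiable_on_const Suc.IH f assms) simp
  qed
qed

section \<open>Smoothness on arbitrary subsets via local extensions\<close>

lemma C_infinity_on_subset:
  "C_infinity_on S f \<Longrightarrow> T \<subseteq> S \<Longrightarrow> C_infinity_on T f"
  unfolding C_infinity_on_def
proof (intro ballI)
  fix x
  assume "\<forall>x\<in>S. \<exists>W g. open W \<and> x \<in> W \<and> (\<forall>n. ktimes_differentiable_on n W g) \<and>
      (\<forall>y\<in>W \<inter> S. g y = f y)" "T \<subseteq> S" "x \<in> T"
  then obtain W g where "open W" "x \<in> W" "\<forall>n. ktimes_differentiable_on n W g"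
    "\<forall>y\<in>W \<inter> S. g y = f y"
    by (metis subsetD)
  with \<open>T \<subseteq> S\<close> show "\<exists>W g. open W \<and> x \<in> W \<and>
      (\<forall>n. ktimes_differentiable_on n W g) \<and> (\<forall>y\<in>W \<inter> T. g y = f y)"
    by (intro exI[of _ W] exI[of _ g]) auto
qed

lemma C_infinity_on_cong:
  "(\<And>x. x \<in> S \<Longrightarrow> f x = g x) \<Longrightarrow> C_infinity_on S f \<longleftrightarrow> C_infinity_on S g"
  unfolding C_infinity_on_def by simp

lemma C_infinity_on_const: "C_infinity_on S (\<lambda>x. c)"
  unfolding C_infinity_on_def
  by (intro ballI exI[of _ UNIV] exI[of _ "\<lambda>x. c"]) (simp add: ktimes_differentiable_on_const)

text \<open>An extension witnessing smoothness on \<open>V \<inter> S\<close> agrees with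
  \<open>f\<close> on all of \<open>S\<close> once its domain is cut down to
  \<open>V\<close>.\<close>

lemma C_infinity_on_local:
  assumes "\<And>x. x \<in> S \<Longrightarrow> \<exists>V. open V \<and> x \<in> V \<and> C_infinity_on (V \<inter> S) f"
  shows "C_infinity_on S f"
  unfolding C_infinity_on_def
proof
  fix x assume "x \<in> S"
  then obtain V where V: "open V" "x \<in> V" "C_infinity_on (V \<inter> S) f"
    using assms by blast
  then obtain W g where W: "open W" "x \<in> W" "\<forall>n. ktimes_differentiable_on n W g"
    "\<forall>y\<in>W \<inter> (V \<inter> S). g y = f y"
    using \<open>x \<in> S\<close> unfolding C_infinity_on_def by blast
  show "\<exists>W g. open W \<and> x \<in> W \<and> (\<forall>n. ktimes_differentiable_on n W g) \<and> (\<forall>y\<in>W \<inter> S. g y = f y)"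
    using V W ktimes_differentiable_on_subset[of _ W g "W \<inter> V"]
    by (intro exI[of _ "W \<inter> V"] exI[of _ g]) auto
qed

text \<open>Local extensions of the two arguments are combined on the intersection of their domains.
  A unary operation is covered by letting \<open>F\<close> ignore its second argument.\<close>

lemma C_infinity_on_binary:
  fixes S :: "'a::real_normed_vector set"
  assumes "\<And>(W :: 'a set) n f g. open W \<Longrightarrow> ktimes_differentiable_on n W f \<Longrightarrow>
      ktimes_differentiable_on n W g \<Longrightarrow> ktimes_differentiable_on n W (\<lambda>x. F (f x) (g x))"
    and "C_infinity_on S f" "C_infinity_on S g"
  shows "C_infinity_on S (\<lambda>x. F (f x) (g x))"
  unfolding C_infinity_on_def
proof
  fix x assume "x \<in> S"
  obtain V f' where V: "open V" "x \<in> V" "\<forall>n. ktimes_differentiable_on n V f'"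
    "\<forall>y\<in>V \<inter> S. f' y = f y"
    using assms(2) \<open>x \<in> S\<close> unfolding C_infinity_on_def by meson
  obtain W g' where W: "open W" "x \<in> W" "\<forall>n. ktimes_differentiable_on n W g'"
    "\<forall>y\<in>W \<inter> S. g' y = g y"
    using assms(3) \<open>x \<in> S\<close> unfolding C_infinity_on_def by meson
  show "\<exists>W h. open W \<and> x \<in> W \<and> (\<forall>n. ktimes_differentiable_on n W h) \<and>
      (\<forall>y\<in>W \<inter> S. h y = F (f y) (g y))"
  proof (intro exI conjI allI)
    show "ktimes_differentiable_on n (V \<inter> W) (\<lambda>x. F (f' x) (g' x))" for n
      using V W
        ktimes_differentiable_on_subset[of n V f' "V \<inter> W"]
        ktimes_differentiable_on_subset[of n W g' "V \<inter> W"]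
      by (intro assms(1)[of "V \<inter> W" n f' g']) auto
  qed (use V W in auto)
qed

lemma C_infinity_on_add:
  "C_infinity_on S f \<Longrightarrow> C_infinity_on S g \<Longrightarrow> C_infinity_on S (\<lambda>x. f x + g x)"
  by (rule C_infinity_on_binary[where F = "(+)"]) (rule ktimes_differentiable_on_add)

lemma (in bounded_bilinear) C_infinity_on:
  "C_infinity_on S f \<Longrightarrow> C_infinity_on S g \<Longrightarrow> C_infinity_on S (\<lambda>x. prod (f x) (g x))"
  by (rule C_infinity_on_binary[where F = prod]) (rule ktimes_differentiable_on)

lemma C_infinity_on_flat_exp:
  "C_infinity_on S f \<Longrightarrow> C_infinity_on S (\<lambda>x. flat_exp k (f x))"
  by (rule C_infinity_on_binary[where F = "\<lambda>t _. flat_exp k t" and g = f])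
    (rule ktimes_differentiable_on_flat_exp)

section \<open>Smooth functions on manifolds\<close>

lemma chartD:
  assumes "smooth_manifold M" "(U, \<phi>) \<in> atlas M"
  shows "open U" and "openin (top_of_set (model M)) (\<phi> ` U)"
    and "homeomorphism U (\<phi> ` U) \<phi> (inv_into U \<phi>)"
    and "q \<in> U \<Longrightarrow> inv_into U \<phi> (\<phi> q) = q"
proof -
  show "open U" "openin (top_of_set (model M)) (\<phi> ` U)"
    and hom: "homeomorphism U (\<phi> ` U) \<phi> (inv_into U \<phi>)"
    using assms by (auto simp: smooth_manifold_def)
  show "q \<in> U \<Longrightarrow> inv_into U \<phi> (\<phi> q) = q"
    using hom by (simp add: homeomorphism_def)
qed

lemma transition_smooth:
  assumes "smooth_manifold M" "(U, \<phi>) \<in> atlas M" "(V, \<psi>) \<in> atlas M"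
  shows "C_infinity_on (\<phi> ` (U \<inter> V)) (\<psi> \<circ> inv_into U \<phi>)"
proof -
  have "\<forall>(U, \<phi>)\<in>atlas M. \<forall>(V, \<psi>)\<in>atlas M. C_infinity_on (\<phi> ` (U \<inter> V)) (\<psi> \<circ> inv_into U \<phi>)"
    using assms(1) by (simp add: smooth_manifold_def)
  with assms(2,3) show ?thesis by blast
qed

lemma smooth_fun_onD:
  "smooth_fun_on M W f \<Longrightarrow> (U, \<phi>) \<in> atlas M \<Longrightarrow> C_infinity_on (\<phi> ` (U \<inter> W)) (f \<circ> inv_into U \<phi>)"
  by (auto simp: smooth_fun_on_def)

lemma smooth_fun_on_cong:
  assumes "smooth_manifold M" "smooth_fun_on M W f" "\<And>p. p \<in> W \<Longrightarrow> f p = g p"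
  shows "smooth_fun_on M W g"
  unfolding smooth_fun_on_def
proof clarify
  fix U \<phi> assume chart: "(U, \<phi>) \<in> atlas M"
  have "C_infinity_on (\<phi> ` (U \<inter> W)) (f \<circ> inv_into U \<phi>) \<longleftrightarrow>
      C_infinity_on (\<phi> ` (U \<inter> W)) (g \<circ> inv_into U \<phi>)"
    by (rule C_infinity_on_cong) (use chartD(4)[OF assms(1) chart] assms(3) in auto)
  then show "C_infinity_on (\<phi> ` (U \<inter> W)) (g \<circ> inv_into U \<phi>)"
    using smooth_fun_onD[OF assms(2) chart] by simp
qed

lemma smooth_fun_on_subset: "smooth_fun_on M W f \<Longrightarrow> V \<subseteq> W \<Longrightarrow> smooth_fun_on M V f"
  unfolding smooth_fun_on_def by (fastforce intro: C_infinity_on_subset)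

lemma smooth_fun_on_const: "smooth_fun_on M W (\<lambda>p. c)"
  unfolding smooth_fun_on_def by (auto simp: o_def intro: C_infinity_on_const)

lemma smooth_fun_on_add:
  "smooth_fun_on M W f \<Longrightarrow> smooth_fun_on M W g \<Longrightarrow> smooth_fun_on M W (\<lambda>p. f p + g p)"
  unfolding smooth_fun_on_def by (fastforce simp: o_def intro: C_infinity_on_add)

lemma smooth_fun_on_mult:
  "smooth_fun_on M W f \<Longrightarrow> smooth_fun_on M W g \<Longrightarrow> smooth_fun_on M W (\<lambda>p. f p * g p)"
  unfolding smooth_fun_on_def
  by (fastforce simp: o_def intro: bounded_bilinear.C_infinity_on[OF bounded_bilinear_mult])

lemma smooth_fun_on_sum:
  "finite I \<Longrightarrow> (\<And>i. i \<in> I \<Longrightarrow> smooth_fun_on M W (f i)) \<Longrightarrow> smooth_fun_on M W (\<lambda>p. \<Sum>i\<in>I. f i p)"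
  by (induction I rule: finite_induct) (auto intro: smooth_fun_on_const smooth_fun_on_add)

text \<open>A chart is a homeomorphism onto its image, so a neighbourhood \<open>V\<close> in the
  manifold becomes the trace of an open set \<open>T\<close> of the ambient Euclidean space, and
  \<open>C_infinity_on_local\<close> applies there.\<close>

lemma smooth_fun_on_local:
  assumes M: "smooth_manifold M"
    and loc: "\<And>p. p \<in> W \<Longrightarrow> \<exists>V. open V \<and> p \<in> V \<and> smooth_fun_on M (V \<inter> W) f"
  shows "smooth_fun_on M W f"
  unfolding smooth_fun_on_def
proof clarify
  fix U \<phi> assume chart: "(U, \<phi>) \<in> atlas M"
  note chart_facts = chartD[OF M chart]
  show "C_infinity_on (\<phi> ` (U \<inter> W)) (f \<circ> inv_into U \<phi>)"
  proof (rule C_infinity_on_local)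
    fix x assume "x \<in> \<phi> ` (U \<inter> W)"
    then obtain q where q: "q \<in> U" "q \<in> W" "x = \<phi> q" by auto
    obtain V where V: "open V" "q \<in> V" "smooth_fun_on M (V \<inter> W) f"
      using loc q by blast
    have "openin (top_of_set (\<phi> ` U)) (\<phi> ` (U \<inter> V))"
      by (rule homeomorphism_imp_open_map[OF chart_facts(3)]) (use V in auto)
    then obtain T where T: "open T" "\<phi> ` (U \<inter> V) = \<phi> ` U \<inter> T"
      by (auto simp: openin_open)
    \<comment> \<open>The preimages provided by \<open>W\<close> and by \<open>V\<close> are a
      priori two points of \<open>U\<close>; injectivity of the chart identifies them.\<close>
    have "T \<inter> \<phi> ` (U \<inter> W) \<subseteq> \<phi> ` (U \<inter> (V \<inter> W))"
    proof
      fix y assume "y \<in> T \<inter> \<phi> ` (U \<inter> W)"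
      then obtain a where a: "a \<in> U" "a \<in> W" "y = \<phi> a" "y \<in> T" by auto
      then obtain b where b: "b \<in> U" "b \<in> V" "y = \<phi> b" using T by blast
      then have "a = b" using chart_facts(4) a by metis
      with a b show "y \<in> \<phi> ` (U \<inter> (V \<inter> W))" by auto
    qed
    then have "C_infinity_on (T \<inter> \<phi> ` (U \<inter> W)) (f \<circ> inv_into U \<phi>)"
      using smooth_fun_onD[OF V(3) chart] C_infinity_on_subset by blast
    moreover have "x \<in> T" using T q V by blast
    ultimately show "\<exists>V. open V \<and> x \<in> V \<and> C_infinity_on (V \<inter> \<phi> ` (U \<inter> W)) (f \<circ> inv_into U \<phi>)"
      using T by blast
  qed
qed

text \<open>The open sets \<open>U\<close> and \<open>- S\<close> cover the manifold; the extension
  equals \<open>f\<close> on the first and 0 on the second. The set \<open>W\<close> allows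
  functions that are meaningful only over part of the manifold, such as coefficients in a local
  frame.\<close>

lemma smooth_fun_on_extend_by_zero:
  assumes M: "smooth_manifold M" and "open U" "closed S" "S \<subseteq> U"
    and f: "smooth_fun_on M (U \<inter> W) f" and "\<And>q. q \<in> U - S \<Longrightarrow> f q = 0"
  shows "smooth_fun_on M W (\<lambda>q. if q \<in> U then f q else 0)" (is "smooth_fun_on M W ?F")
proof (rule smooth_fun_on_local[OF M])
  fix p assume "p \<in> W"
  show "\<exists>V. open V \<and> p \<in> V \<and> smooth_fun_on M (V \<inter> W) ?F"
  proof (cases "p \<in> U")
    case True
    have "smooth_fun_on M (U \<inter> W) ?F" by (rule smooth_fun_on_cong[OF M f]) auto
    with True assms(2) show ?thesis by blast
  next
    case False
    have "smooth_fun_on M (- S \<inter> W) ?F"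
      by (rule smooth_fun_on_cong[OF M smooth_fun_on_const[of _ _ 0]]) (use assms in auto)
    with False assms show ?thesis by (intro exI[of _ "- S"]) auto
  qed
qed

lemma smooth_bump_exists:
  fixes M :: "('m::{t2_space,second_countable_topology}, 'b::euclidean_space) manifold"
  assumes M: "smooth_manifold M" and U: "open U" "p \<in> U"
  obtains \<eta> S where "\<eta> \<in> smooth_funs M" "\<eta> p = 1" "closed S" "S \<subseteq> U" "\<And>q. q \<notin> S \<Longrightarrow> \<eta> q = 0"
proof -
  have "p \<in> (\<Union>(V, \<phi>)\<in>atlas M. V)"
    using M by (simp add: smooth_manifold_def)
  then obtain V \<phi> where chart: "(V, \<phi>) \<in> atlas M" and p: "p \<in> V" by auto
  note chart_facts = chartD[OF M chart]
  let ?\<psi> = "inv_into V \<phi>"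
  have "openin (top_of_set (\<phi> ` V)) (\<phi> ` (V \<inter> U))"
    by (rule homeomorphism_imp_open_map[OF chart_facts(3)]) (use U in auto)
  then have "openin (top_of_set (model M)) (\<phi> ` (V \<inter> U))"
    using chart_facts(2) openin_trans by blast
  \<comment> \<open>The whole closed ball, within the model space, has to lie in the chart image of
    \<open>V \<inter> U\<close>, so that its preimage is a compact subset of
    \<open>U\<close>.\<close>
  then obtain r where r: "r > 0" "cball (\<phi> p) r \<inter> model M \<subseteq> \<phi> ` (V \<inter> U)"
    unfolding openin_contains_cball using p U by blast
  define K where "K = cball (\<phi> p) r \<inter> model M"
  define S where "S = ?\<psi> ` K"
  have K_sub: "K \<subseteq> \<phi> ` V" using r by (auto simp: K_def)
  have "subspace (model M)" using M by (simp add: smooth_manifold_def)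
  then have "compact K"
    unfolding K_def using closed_subspace compact_cball compact_Int_closed by blast
  then have "compact S"
    unfolding S_def using chart_facts(3) K_sub
    by (intro compact_continuous_image) (auto simp: homeomorphism_def intro: continuous_on_subset)
  \<comment> \<open>This uses that the manifold is Hausdorff. Closedness in the whole manifold, and
    not merely in \<open>V\<close>, is what makes the extension by zero smooth.\<close>
  then have "closed S" by (rule compact_imp_closed)
  have "S \<subseteq> V \<inter> U"
    using r(2) chart_facts(4) by (auto simp: S_def K_def)
  \<comment> \<open>On \<open>V\<close>, \<open>h\<close> is positive exactly where the chart
    distance from \<open>p\<close> is less than \<open>r\<close>, so \<open>flat_exp 0\<close> cuts
    it off smoothly at the sphere. Dividing by the value at the centre gives
    \<open>\<beta> p = 1\<close>.\<close>
  define h where "h q = r\<^sup>2 - (\<phi> q - \<phi> p) \<bullet> (\<phi> q - \<phi> p)" for q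
  define \<beta> where "\<beta> q = flat_exp 0 (h q) * inverse (flat_exp 0 (r\<^sup>2))" for q
  have \<beta>0: "\<beta> q = 0" if "q \<in> V - S" for q
  proof -
    have "\<phi> q \<in> model M" using chart_facts(2) that by (auto dest: openin_imp_subset)
    moreover have "\<phi> q \<notin> K"
      using that chart_facts(4)[of q] unfolding S_def by (metis DiffD1 DiffD2 imageI)
    ultimately have "norm (\<phi> q - \<phi> p) > r"
      by (simp add: K_def dist_norm norm_minus_commute[of "\<phi> p"])
    then have "(norm (\<phi> q - \<phi> p))\<^sup>2 > r\<^sup>2" using r(1) by (simp add: power_strict_mono)
    then have "\<not> h q > 0" by (simp add: h_def dot_square_norm)
    then show ?thesis by (simp add: \<beta>_def flat_exp_def)
  qed
  have "smooth_fun_on M V \<beta>"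
    unfolding smooth_fun_on_def
  proof clarify
    fix V' \<phi>' assume chart': "(V', \<phi>') \<in> atlas M"
    \<comment> \<open>The function is built from the chart map \<open>\<phi>\<close>; seen in
      another chart, this map is the transition map.\<close>
    have "C_infinity_on (\<phi>' ` (V' \<inter> V)) (\<phi> \<circ> inv_into V' \<phi>')"
      by (rule transition_smooth[OF M chart' chart])
    then have trans: "C_infinity_on (\<phi>' ` (V' \<inter> V)) (\<lambda>x. \<phi> (inv_into V' \<phi>' x) + - \<phi> p)"
      using C_infinity_on_add[OF _ C_infinity_on_const[of _ "- \<phi> p"]] by (simp only: o_def)
    note mult = bounded_bilinear.C_infinity_on[OF bounded_bilinear_mult]
    note inner = bounded_bilinear.C_infinity_on[OF bounded_bilinear_inner]
    note add = C_infinity_on_add[OF C_infinity_on_const]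
    have "C_infinity_on (\<phi>' ` (V' \<inter> V)) (\<lambda>x. flat_exp 0 (r\<^sup>2 + -1 *
        ((\<phi> (inv_into V' \<phi>' x) + - \<phi> p) \<bullet> (\<phi> (inv_into V' \<phi>' x) + - \<phi> p))) * inverse (flat_exp 0 (r\<^sup>2)))"
      by (rule mult[OF C_infinity_on_flat_exp[OF add[OF mult[OF C_infinity_on_const
                inner[OF trans trans]]]] C_infinity_on_const])
    then show "C_infinity_on (\<phi>' ` (V' \<inter> V)) (\<beta> \<circ> inv_into V' \<phi>')"
      by (simp add: o_def \<beta>_def h_def)
  qed
  then have "smooth_fun_on M UNIV (\<lambda>q. if q \<in> V then \<beta> q else 0)"
    using \<open>closed S\<close> \<open>S \<subseteq> V \<inter> U\<close> chart_facts(1) \<beta>0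
    by (intro smooth_fun_on_extend_by_zero[OF M, where S = S]) auto
  then have "(\<lambda>q. if q \<in> V then \<beta> q else 0) \<in> smooth_funs M"
    by (simp add: smooth_funs_def)
  moreover have "\<beta> p = 1" using r(1) by (simp add: \<beta>_def h_def flat_exp_def)
  ultimately show thesis
    using \<open>closed S\<close> \<open>S \<subseteq> V \<inter> U\<close> \<beta>0 p
    by (intro that[of "\<lambda>q. if q \<in> V then \<beta> q else 0" S]) auto
qed

section \<open>Linear algebra of fibres\<close>

lemma linear_between_sum:
  assumes "linear_between V W f" "subspace V" "finite I" "\<And>i. i \<in> I \<Longrightarrow> x i \<in> V"
  shows "f (\<Sum>i\<in>I. c i *\<^sub>R x i) = (\<Sum>i\<in>I. c i *\<^sub>R f (x i))"
  using assms(3,4)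
proof (induction I rule: finite_induct)
  case empty
  have "f (0 *\<^sub>R 0 + 0 *\<^sub>R 0) = 0 *\<^sub>R f 0 + 0 *\<^sub>R f 0"
    using assms(1,2) unfolding linear_between_def by (meson subspace_0)
  then show ?case by simp
next
  case (insert i I)
  have "(\<Sum>i\<in>I. c i *\<^sub>R x i) \<in> V"
    using insert assms(2) by (auto intro: subspace_sum subspace_scale)
  then have "f (c i *\<^sub>R x i + 1 *\<^sub>R (\<Sum>i\<in>I. c i *\<^sub>R x i)) =
      c i *\<^sub>R f (x i) + 1 *\<^sub>R f (\<Sum>i\<in>I. c i *\<^sub>R x i)"
    using insert assms(1) unfolding linear_between_def by blast
  then show ?case using insert by simp
qed

lemma linear_betweenD:
  assumes "linear_between V W f"
  shows "x \<in> V \<Longrightarrow> f x \<in> W"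
    and "x \<in> V \<Longrightarrow> y \<in> V \<Longrightarrow> f (c *\<^sub>R x + d *\<^sub>R y) = c *\<^sub>R f x + d *\<^sub>R f y"
  using assms by (auto simp: linear_between_def)

lemma linear_between_add:
  "linear_between V W f \<Longrightarrow> x \<in> V \<Longrightarrow> y \<in> V \<Longrightarrow> f (x + y) = f x + f y"
  using linear_betweenD(2)[of V W f x y 1 1] by simp

lemma linear_between_scaleR:
  "linear_between V W f \<Longrightarrow> x \<in> V \<Longrightarrow> f (c *\<^sub>R x) = c *\<^sub>R f x"
  using linear_betweenD(2)[of V W f x x c 0] by simp

lemma linear_between_zero: "linear_between V W f \<Longrightarrow> subspace V \<Longrightarrow> f 0 = 0"
  using linear_between_scaleR[of V W f 0 0] subspace_0 by fastforce

lemma linear_between_eq_on_span: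
  assumes "linear_between (span B) W f" "linear_between (span B) W h"
    and "finite B" "\<And>b. b \<in> B \<Longrightarrow> f b = h b" "x \<in> span B"
  shows "f x = h x"
proof -
  obtain t where "x = (\<Sum>b\<in>B. t b *\<^sub>R b)"
    using assms(3,5) by (auto simp: span_finite)
  then show ?thesis
    using linear_between_sum[OF assms(1) subspace_span assms(3), of "\<lambda>b. b" t]
      linear_between_sum[OF assms(2) subspace_span assms(3), of "\<lambda>b. b" t] assms(4)
    by (simp add: span_base)
qed

lemma linear_between_coordinate:
  assumes "independent B"
  shows "linear_between (span B) UNIV (\<lambda>x. representation B x b)"
  using assms by (auto simp: linear_between_def real_vector.representation_add
      real_vector.representation_scale span_scale)

text \<open>An injective endomorphism of a finite-dimensional space is surjective; it is applied to the
  Gram matrix of \<open>b\<close>.\<close>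

lemma nondegenerate_form_representable:
  fixes b :: "'e::real_vector \<Rightarrow> 'e \<Rightarrow> 'r::real_vector"
  assumes B: "finite B" "independent B" and r0: "r0 \<noteq> 0"
    and lin: "\<And>x. x \<in> span B \<Longrightarrow> linear_between (span B) (span {r0}) (b x)"
    and sym: "\<And>x y. x \<in> span B \<Longrightarrow> y \<in> span B \<Longrightarrow> b x y = b y x"
    and nondeg: "\<And>x. x \<in> span B \<Longrightarrow> (\<And>y. y \<in> span B \<Longrightarrow> b x y = 0) \<Longrightarrow> x = 0"
    and \<alpha>: "linear_between (span B) (span {r0}) \<alpha>"
  obtains u where "u \<in> span B" "\<And>w. w \<in> span B \<Longrightarrow> b u w = \<alpha> w"
proof -
  have indep: "independent {r0}" using r0 by simp
  \<comment> \<open>The coordinate \<open>k\<close> identifies the line spanned by \<open>r0\<close>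
    with the reals, making the form and the functional real-valued.\<close>
  define k where "k y = representation {r0} y r0" for y
  have k_lin: "linear_between (span {r0}) UNIV k"
    unfolding k_def by (rule linear_between_coordinate[OF indep])
  have k_coord: "k y *\<^sub>R r0 = y" if "y \<in> span {r0}" for y
    using real_vector.sum_representation_eq[OF indep that, of "{r0}"] by (simp add: k_def)
  have k_inj: "y = z" if "y \<in> span {r0}" "z \<in> span {r0}" "k y = k z" for y z
    using k_coord[OF that(1)] k_coord[OF that(2)] that(3) by metis
  \<comment> \<open>The coordinates of \<open>F x\<close> are the pairings of \<open>x\<close> with
    the basis vectors. Solving \<open>b u w = \<alpha> w\<close> on basis vectors thus means finding
    a preimage under \<open>F\<close>.\<close>
  define F where "F x = (\<Sum>c\<in>B. k (b x c) *\<^sub>R c)" for x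
  have F_in: "F x \<in> span B" for x
    by (auto simp: F_def intro: span_sum span_scale span_base)
  have coeffs: "s c = t c" if "(\<Sum>c\<in>B. s c *\<^sub>R c) = (\<Sum>c\<in>B. t c *\<^sub>R c)" "c \<in> B"
    for s t :: "'e \<Rightarrow> real" and c
  proof -
    have "(\<Sum>c\<in>B. (s c - t c) *\<^sub>R c) = 0"
      using that(1) by (simp add: scaleR_left_diff_distrib sum_subtractf)
    from independentD[OF B(2) B(1) order_refl this that(2)] show ?thesis by simp
  qed
  have F_lin: "linear_between (span B) UNIV F"
    unfolding linear_between_def
  proof (intro conjI ballI allI UNIV_I)
    fix x y c d assume xy: "x \<in> span B" "y \<in> span B"
    have "k (b (c *\<^sub>R x + d *\<^sub>R y) e) = c * k (b x e) + d * k (b y e)" if "e \<in> B" for e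
    proof -
      have e: "e \<in> span B" using that by (simp add: span_base)
      have "b (c *\<^sub>R x + d *\<^sub>R y) e = c *\<^sub>R b x e + d *\<^sub>R b y e"
        using linear_betweenD(2)[OF lin[OF e] xy, of c d] sym[OF e xy(1)] sym[OF e xy(2)]
          sym[OF e, of "c *\<^sub>R x + d *\<^sub>R y"] xy
        by (simp only: span_add span_scale)
      then show ?thesis
        using linear_betweenD(2)[OF k_lin, of "b x e" "b y e"] linear_betweenD(1)[OF lin e] xy
        by simp
    qed
    then show "F (c *\<^sub>R x + d *\<^sub>R y) = c *\<^sub>R F x + d *\<^sub>R F y"
      by (simp add: F_def scaleR_left_distrib sum.distrib scaleR_sum_right)
  qed
  \<comment> \<open>\<open>F\<close> is linear only on \<open>span B\<close>; \<open>f\<close> is a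
    linear map of the whole type with the same values there.\<close>
  obtain f where f: "linear f" "\<And>c. c \<in> B \<Longrightarrow> f c = F c"
    using linear_independent_extend[OF B(2), of F] by blast
  have f_F: "f x = F x" if "x \<in> span B" for x
  proof (rule linear_between_eq_on_span[OF _ F_lin B(1) f(2) that])
    show "linear_between (span B) UNIV f"
      using f(1) by (simp add: linear_between_def linear_add linear_scale)
  qed
  have eq_if_F: "x = 0" if "x \<in> span B" "F x = 0" for x
  proof (rule nondeg[OF that(1)])
    fix y assume y: "y \<in> span B"
    have "b x c = 0" if "c \<in> B" for c
    proof -
      have "k (b x c) = 0"
        using coeffs[of "\<lambda>c. k (b x c)" "\<lambda>c. 0" c] \<open>F x = 0\<close> that by (simp add: F_def)
      moreover have "k 0 = 0" by (rule linear_between_zero[OF k_lin subspace_span])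
      ultimately show ?thesis
        using linear_betweenD(1)[OF lin[OF \<open>x \<in> span B\<close>] span_base[OF that]]
        by (intro k_inj) (auto intro: span_zero)
    qed
    moreover have "linear_between (span B) (span {r0}) (\<lambda>_. 0)"
      by (simp add: linear_between_def span_zero)
    ultimately show "b x y = 0"
      using linear_between_eq_on_span[OF lin[OF \<open>x \<in> span B\<close>] _ B(1) _ y] by simp
  qed
  have inj: "inj_on f (span B)"
    unfolding linear_injective_on_subspace_0[OF f(1) subspace_span]
    using eq_if_F f_F by simp
  then have indep_f: "independent (f ` B)"
    using real_vector.linear_independent_injective_image[OF f(1) B(2)] by blast
  have card_f: "card (f ` B) = card B"
    using inj by (meson card_image inj_on_subset span_superset)
  have f_in: "f ` B \<subseteq> span B" using f(2) F_in by auto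
  have "span B \<subseteq> span (f ` B)"
  proof
    fix y assume "y \<in> span B"
    show "y \<in> span (f ` B)"
    proof (rule ccontr)
      assume y: "y \<notin> span (f ` B)"
      then have "independent (insert y (f ` B))"
        using indep_f by (simp add: independent_insert)
      then have "card (insert y (f ` B)) \<le> card B"
        using independent_span_bound[OF B(1)] f_in \<open>y \<in> span B\<close> by blast
      moreover have "y \<notin> f ` B" using y span_base[of y "f ` B"] by metis
      ultimately show False using B(1) card_f by simp
    qed
  qed
  also have "span (f ` B) = f ` span B"
    by (rule span_linear_image[OF f(1)])
  finally have "span B \<subseteq> f ` span B" .
  moreover have "(\<Sum>c\<in>B. k (\<alpha> c) *\<^sub>R c) \<in> span B"
    by (auto intro: span_sum span_scale span_base)
  ultimately obtain u where u: "u \<in> span B" "(\<Sum>c\<in>B. k (\<alpha> c) *\<^sub>R c) = f u"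
    by (meson imageE subsetD)
  have "b u c = \<alpha> c" if "c \<in> B" for c
  proof (rule k_inj)
    show "b u c \<in> span {r0}" "\<alpha> c \<in> span {r0}"
      using linear_betweenD(1)[OF \<alpha>] linear_betweenD(1)[OF lin[OF u(1)]] span_base[OF that]
      by blast+
    have "(\<Sum>c\<in>B. k (b u c) *\<^sub>R c) = (\<Sum>c\<in>B. k (\<alpha> c) *\<^sub>R c)"
      using u(2) f_F[OF u(1)] by (simp only: F_def)
    from coeffs[OF this that] show "k (b u c) = k (\<alpha> c)" .
  qed
  then have "b u w = \<alpha> w" if "w \<in> span B" for w
    by (rule linear_between_eq_on_span[OF lin[OF u(1)] \<alpha> B(1) _ that])
  with u(1) show thesis by (rule that)
qed

section \<open>Sections of vector bundles\<close>

lemma vector_bundle_frame: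
  assumes "vector_bundle M E"
  obtains U s where "(U, s) \<in> frames E" "p \<in> U"
proof -
  have "p \<in> (\<Union>(U, s)\<in>frames E. U)" using assms by (simp add: vector_bundle_def)
  then show thesis using that by auto
qed

lemma frame_is_local_frame:
  "vector_bundle M E \<Longrightarrow> (U, s) \<in> frames E \<Longrightarrow> local_frame M E U s"
  by (auto simp: vector_bundle_def local_frame_def)

lemma local_frameD:
  assumes "local_frame M E U s"
  shows "open U" "a < rank E \<Longrightarrow> smooth_section_on M E U (s a)" "p \<in> U \<Longrightarrow> fibre_basis E p s"
  using assms by (auto simp: local_frame_def)

lemma subspace_fibre: "vector_bundle M E \<Longrightarrow> subspace (fibre E p)"
  using vector_bundle_frame[of M E p] frame_is_local_frame local_frameD(3) subspace_span
  by (metis fibre_basis_def)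

lemma fibre_basis_in_fibre: "fibre_basis E p s \<Longrightarrow> a < rank E \<Longrightarrow> s a p \<in> fibre E p"
  using span_base[of "s a p" "(\<lambda>a. s a p) ` {..<rank E}"] by (simp add: fibre_basis_def)

lemma linear_between_dual_coframe:
  "fibre_basis E p s \<Longrightarrow> linear_between (fibre E p) UNIV (dual_coframe E s a p)"
  using linear_between_coordinate[of "(\<lambda>a. s a p) ` {..<rank E}" "s a p"]
  by (auto simp: fibre_basis_def dual_coframe_def[abs_def])

lemma dual_coframe_expansion:
  assumes "fibre_basis E p s" "e \<in> fibre E p"
  shows "(\<Sum>a<rank E. dual_coframe E s a p e *\<^sub>R s a p) = e"
proof -
  let ?B = "(\<lambda>a. s a p) ` {..<rank E}"
  have "(\<Sum>b\<in>?B. representation ?B e b *\<^sub>R b) = e"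
    using assms by (intro real_vector.sum_representation_eq) (auto simp: fibre_basis_def)
  then show ?thesis
    using assms(1) by (simp add: fibre_basis_def sum.reindex dual_coframe_def)
qed

lemma dual_coframe_frame:
  assumes "fibre_basis E p s" "a < rank E" "b < rank E"
  shows "dual_coframe E s a p (s b p) = (if a = b then 1 else 0)"
  using assms by (auto simp: fibre_basis_def dual_coframe_def real_vector.representation_basis
      dest: inj_onD)

lemma dual_coframe_combination:
  assumes "fibre_basis E p s" "a < rank E"
  shows "dual_coframe E s a p (\<Sum>b<rank E. c b *\<^sub>R s b p) = c a"
proof -
  have "subspace (fibre E p)" using assms(1) by (metis fibre_basis_def subspace_span)
  then have "dual_coframe E s a p (\<Sum>b<rank E. c b *\<^sub>R s b p) =
      (\<Sum>b<rank E. c b *\<^sub>R dual_coframe E s a p (s b p))"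
    using assms by (intro linear_between_sum[OF linear_between_dual_coframe])
      (auto intro: fibre_basis_in_fibre)
  also have "\<dots> = (\<Sum>b<rank E. if a = b then c b else 0)"
    using assms by (intro sum.cong) (auto simp: dual_coframe_frame)
  finally show ?thesis using assms(2) by simp
qed

lemma smooth_section_on_in_fibre: "smooth_section_on M E W u \<Longrightarrow> p \<in> W \<Longrightarrow> u p \<in> fibre E p"
  by (simp add: smooth_section_on_def)

text \<open>The coefficients whose existence defines smoothness are unique, hence they are the
  values of the dual coframe. Together with \<open>smooth_section_onI\<close> this replaces the
  existential definition by a condition on explicit functions.\<close>

lemma smooth_section_on_dual_coframe:
  assumes M: "smooth_manifold M" and E: "vector_bundle M E" and u: "smooth_section_on M E W u"
    and s: "(U, s) \<in> frames E" and a: "a < rank E"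
  shows "smooth_fun_on M (U \<inter> W) (\<lambda>p. dual_coframe E s a p (u p))"
proof -
  obtain c where c: "\<forall>a<rank E. smooth_fun_on M (U \<inter> W) (c a)"
    "\<forall>p\<in>U \<inter> W. u p = (\<Sum>a<rank E. c a p *\<^sub>R s a p)"
    using bspec[OF conjunct2[OF u[unfolded smooth_section_on_def]] s] by auto
  show ?thesis
  proof (rule smooth_fun_on_cong[OF M])
    show "smooth_fun_on M (U \<inter> W) (c a)" using c(1) a by simp
    fix p assume "p \<in> U \<inter> W"
    then show "c a p = dual_coframe E s a p (u p)"
      using c(2) a dual_coframe_combination[OF local_frameD(3)[OF frame_is_local_frame[OF E s]],
          of p a "\<lambda>a. c a p"] by simp
  qed
qed

lemma smooth_section_onI:
  assumes E: "vector_bundle M E" and fibre: "\<And>p. p \<in> W \<Longrightarrow> u p \<in> fibre E p"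
    and smooth: "\<And>U s a. (U, s) \<in> frames E \<Longrightarrow> a < rank E \<Longrightarrow>
      smooth_fun_on M (U \<inter> W) (\<lambda>p. dual_coframe E s a p (u p))"
  shows "smooth_section_on M E W u"
proof -
  have coeffs: "\<exists>c. (\<forall>a<rank E. smooth_fun_on M (U \<inter> W) (c a)) \<and>
      (\<forall>p\<in>U \<inter> W. u p = (\<Sum>a<rank E. c a p *\<^sub>R s a p))" if "(U, s) \<in> frames E" for U s
    using smooth[OF that] fibre local_frameD(3)[OF frame_is_local_frame[OF E that]]
    by (intro exI[of _ "\<lambda>a p. dual_coframe E s a p (u p)"]) (simp add: dual_coframe_expansion)
  show ?thesis
    unfolding smooth_section_on_def
  proof (intro conjI ballI)
    fix Us assume "Us \<in> frames E"
    then show "case Us of (U, s) \<Rightarrow> \<exists>c. (\<forall>a<rank E. smooth_fun_on M (U \<inter> W) (c a)) \<and>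
        (\<forall>p\<in>U \<inter> W. u p = (\<Sum>a<rank E. c a p *\<^sub>R s a p))"
      using coeffs by (cases Us) simp
  qed (rule fibre)
qed

lemma smooth_section_on_sum:
  assumes M: "smooth_manifold M" and E: "vector_bundle M E" and "finite I"
    and f: "\<And>i. i \<in> I \<Longrightarrow> smooth_fun_on M W (f i)"
    and u: "\<And>i. i \<in> I \<Longrightarrow> smooth_section_on M E W (u i)"
  shows "smooth_section_on M E W (\<lambda>p. \<Sum>i\<in>I. f i p *\<^sub>R u i p)"
proof (rule smooth_section_onI[OF E])
  show "(\<Sum>i\<in>I. f i p *\<^sub>R u i p) \<in> fibre E p" if "p \<in> W" for p
    by (rule subspace_sum[OF subspace_fibre[OF E] subspace_scale[OF subspace_fibre[OF E]]])
      (rule smooth_section_on_in_fibre[OF u that])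
  fix U s a assume s: "(U, s) \<in> frames E" and a: "a < rank E"
  show "smooth_fun_on M (U \<inter> W) (\<lambda>p. dual_coframe E s a p (\<Sum>i\<in>I. f i p *\<^sub>R u i p))"
  proof (rule smooth_fun_on_cong[OF M])
    have "smooth_fun_on M (U \<inter> W) (f i)" if "i \<in> I" for i
      using f[OF that] by (rule smooth_fun_on_subset) auto
    then show "smooth_fun_on M (U \<inter> W) (\<lambda>p. \<Sum>i\<in>I. f i p * dual_coframe E s a p (u i p))"
      using smooth_section_on_dual_coframe[OF M E u s a]
      by (intro smooth_fun_on_sum smooth_fun_on_mult \<open>finite I\<close>) auto
    fix p assume "p \<in> U \<inter> W"
    then have "fibre_basis E p s" "\<And>i. i \<in> I \<Longrightarrow> u i p \<in> fibre E p"
      using local_frameD(3)[OF frame_is_local_frame[OF E s]] smooth_section_on_in_fibre[OF u] by auto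
    then show "(\<Sum>i\<in>I. f i p * dual_coframe E s a p (u i p)) =
        dual_coframe E s a p (\<Sum>i\<in>I. f i p *\<^sub>R u i p)"
      by (subst linear_between_sum[OF linear_between_dual_coframe subspace_fibre[OF E] \<open>finite I\<close>])
        simp_all
  qed
qed

section \<open>Global sections and one-forms with prescribed values\<close>

lemma extend_section_by_zero:
  assumes M: "smooth_manifold M" and E: "vector_bundle M E" and U: "open U" "closed S" "S \<subseteq> U"
    and \<eta>: "\<eta> \<in> smooth_funs M" "\<And>q. q \<notin> S \<Longrightarrow> \<eta> q = 0" and u: "smooth_section_on M E U u"
  shows "(\<lambda>q. if q \<in> U then \<eta> q *\<^sub>R u q else 0) \<in> sections M E"
proof -
  have "smooth_fun_on M V (\<lambda>q. dual_coframe E s a q (if q \<in> U then \<eta> q *\<^sub>R u q else 0))"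
    if V: "(V, s) \<in> frames E" "a < rank E" for V s a
  proof (rule smooth_fun_on_cong[OF M])
    have "smooth_fun_on M (U \<inter> V) \<eta>"
      using \<eta>(1) smooth_fun_on_subset[of M UNIV] by (simp add: smooth_funs_def)
    moreover have "smooth_fun_on M (U \<inter> V) (\<lambda>q. dual_coframe E s a q (u q))"
      using smooth_section_on_dual_coframe[OF M E u V] by (simp add: Int_commute)
    ultimately show "smooth_fun_on M V (\<lambda>q. if q \<in> U then \<eta> q * dual_coframe E s a q (u q) else 0)"
      using U \<eta> by (intro smooth_fun_on_extend_by_zero[OF M, of U S] smooth_fun_on_mult) auto
    fix q assume "q \<in> V"
    then have lin: "linear_between (fibre E q) UNIV (dual_coframe E s a q)"
      by (intro linear_between_dual_coframe local_frameD(3)[OF frame_is_local_frame[OF E V(1)]])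
    then show "(if q \<in> U then \<eta> q * dual_coframe E s a q (u q) else 0) =
        dual_coframe E s a q (if q \<in> U then \<eta> q *\<^sub>R u q else 0)"
      using smooth_section_on_in_fibre[OF u] linear_between_zero[OF lin subspace_fibre[OF E]]
      by (simp add: linear_between_scaleR[OF lin])
  qed
  moreover have "(if q \<in> U then \<eta> q *\<^sub>R u q else 0) \<in> fibre E q" for q
    using smooth_section_on_in_fibre[OF u] subspace_fibre[OF E]
    by (simp add: subspace_0 subspace_scale)
  ultimately show ?thesis
    unfolding sections_def mem_Collect_eq by (intro smooth_section_onI[OF E]) simp_all
qed

text \<open>The vector is spread with constant coefficients over a frame domain around
  \<open>p\<close> and cut off by a bump function equal to 1 at \<open>p\<close>. The existence so
  obtained justifies the \<open>SOME\<close> in the definition.\<close>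

lemma section_through:
  fixes M :: "('m::{t2_space,second_countable_topology}, 'b::euclidean_space) manifold"
  assumes M: "smooth_manifold M" and E: "vector_bundle M E" and e: "e \<in> fibre E p"
  shows "section_through M E p e \<in> sections M E" "section_through M E p e p = e"
proof -
  obtain U s where U: "(U, s) \<in> frames E" "p \<in> U" by (rule vector_bundle_frame[OF E])
  note frame = local_frameD[OF frame_is_local_frame[OF E U(1)]]
  obtain \<eta> S where \<eta>: "\<eta> \<in> smooth_funs M" "\<eta> p = 1" "closed S" "S \<subseteq> U" "\<And>q. q \<notin> S \<Longrightarrow> \<eta> q = 0"
    using smooth_bump_exists[OF M frame(1) U(2)] by blast
  let ?u = "\<lambda>q. if q \<in> U then \<eta> q *\<^sub>R (\<Sum>a<rank E. dual_coframe E s a p e *\<^sub>R s a q) else 0"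
  have "?u \<in> sections M E"
    using \<eta> frame by (intro extend_section_by_zero[OF M E frame(1) \<eta>(3)]
        smooth_section_on_sum[OF M E] smooth_fun_on_const) auto
  moreover have "?u p = e"
    using \<eta> U e frame(3) by (simp add: dual_coframe_expansion)
  ultimately show "section_through M E p e \<in> sections M E" "section_through M E p e p = e"
    unfolding section_through_def
    using someI[of "\<lambda>u. u \<in> sections M E \<and> u p = e" ?u] by auto
qed

lemma one_form_through:
  fixes M :: "('m::{t2_space,second_countable_topology}, 'b::euclidean_space) manifold"
  assumes M: "smooth_manifold M" and E: "vector_bundle M E"
    and \<omega>: "linear_between (fibre E p) UNIV \<omega>"
  shows "one_form_through M E p \<omega> \<in> one_forms M E"
    and "e \<in> fibre E p \<Longrightarrow> one_form_through M E p \<omega> p e = \<omega> e"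
proof -
  obtain U s where U: "(U, s) \<in> frames E" "p \<in> U" by (rule vector_bundle_frame[OF E])
  note frame = local_frameD[OF frame_is_local_frame[OF E U(1)]]
  obtain \<eta> S where \<eta>: "\<eta> \<in> smooth_funs M" "\<eta> p = 1" "closed S" "S \<subseteq> U" "\<And>q. q \<notin> S \<Longrightarrow> \<eta> q = 0"
    using smooth_bump_exists[OF M frame(1) U(2)] by blast
  \<comment> \<open>Over the frame domain this is \<open>\<omega>\<close> continued with its
    constant coefficients \<open>\<omega> (s a p)\<close> in the dual coframe, times the bump
    function.\<close>
  define \<Omega> where "\<Omega> q x =
    (if q \<in> U then \<eta> q * (\<Sum>a<rank E. \<omega> (s a p) * dual_coframe E s a q x) else 0)" for q x
  have "linear_between (fibre E q) UNIV (\<Omega> q)" for q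
    unfolding linear_between_def
  proof (intro conjI ballI allI UNIV_I)
    fix x y c d assume "x \<in> fibre E q" "y \<in> fibre E q"
    then have "q \<in> U \<Longrightarrow> dual_coframe E s a q (c *\<^sub>R x + d *\<^sub>R y) =
        c * dual_coframe E s a q x + d * dual_coframe E s a q y" for a
      using linear_betweenD(2)[OF linear_between_dual_coframe[OF frame(3)]] by simp
    then show "\<Omega> q (c *\<^sub>R x + d *\<^sub>R y) = c *\<^sub>R \<Omega> q x + d *\<^sub>R \<Omega> q y"
      by (simp add: \<Omega>_def algebra_simps sum.distrib sum_distrib_left)
  qed
  moreover have "smooth_fun_on M W (\<lambda>q. \<Omega> q (u q))" if u: "smooth_section_on M E W u" for W u
  proof -
    have "smooth_fun_on M (U \<inter> W) \<eta>"
      using \<eta>(1) smooth_fun_on_subset[of M UNIV] by (simp add: smooth_funs_def)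
    then have "smooth_fun_on M (U \<inter> W)
        (\<lambda>q. \<eta> q * (\<Sum>a<rank E. \<omega> (s a p) * dual_coframe E s a q (u q)))"
      using smooth_section_on_dual_coframe[OF M E u U(1)]
      by (intro smooth_fun_on_mult smooth_fun_on_sum smooth_fun_on_const) auto
    then show ?thesis
      unfolding \<Omega>_def using \<eta> by (intro smooth_fun_on_extend_by_zero[OF M frame(1) \<eta>(3)]) auto
  qed
  ultimately have "\<Omega> \<in> one_forms M E" by (simp add: one_forms_def)
  moreover have "\<Omega> p e = \<omega> e" if e: "e \<in> fibre E p" for e
  proof -
    have "\<omega> e = \<omega> (\<Sum>a<rank E. dual_coframe E s a p e *\<^sub>R s a p)"
      using e U frame(3) by (simp add: dual_coframe_expansion)
    also have "\<dots> = (\<Sum>a<rank E. dual_coframe E s a p e *\<^sub>R \<omega> (s a p))"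
      using fibre_basis_in_fibre[OF frame(3)[OF U(2)]]
      by (intro linear_between_sum[OF \<omega> subspace_fibre[OF E]]) auto
    finally show ?thesis using U \<eta>(2) by (simp add: \<Omega>_def mult.commute)
  qed
  ultimately have *: "one_form_through M E p \<omega> \<in> one_forms M E \<and>
      (\<forall>e\<in>fibre E p. one_form_through M E p \<omega> p e = \<omega> e)"
    unfolding one_form_through_def
    by (intro someI[of "\<lambda>\<Omega>. \<Omega> \<in> one_forms M E \<and> (\<forall>e\<in>fibre E p. \<Omega> p e = \<omega> e)" \<Omega>]) blast
  show "one_form_through M E p \<omega> \<in> one_forms M E"
    and "e \<in> fibre E p \<Longrightarrow> one_form_through M E p \<omega> p e = \<omega> e"
    using * by auto
qed

section \<open>Connections are pointwise in the direction\<close>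

lemma E_connectionD:
  assumes "E_connection M E \<rho> R D" "r \<in> sections M R"
  shows "u \<in> sections M E \<Longrightarrow> D u r \<in> sections M R"
    and "u \<in> sections M E \<Longrightarrow> v \<in> sections M E \<Longrightarrow>
      D (\<lambda>p. c *\<^sub>R u p + d *\<^sub>R v p) r = (\<lambda>p. c *\<^sub>R D u r p + d *\<^sub>R D v r p)"
    and "f \<in> smooth_funs M \<Longrightarrow> u \<in> sections M E \<Longrightarrow>
      D (\<lambda>p. f p *\<^sub>R u p) r = (\<lambda>p. f p *\<^sub>R D u r p)"
  using assms by (simp_all add: E_connection_def real_bilinear_sections_def)

lemma sections_in_fibre: "u \<in> sections M E \<Longrightarrow> u p \<in> fibre E p"
  by (simp add: sections_def smooth_section_on_def)

lemma sections_sum: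
  assumes "smooth_manifold M" "vector_bundle M E" "finite I"
    and "\<And>i. i \<in> I \<Longrightarrow> f i \<in> smooth_funs M" "\<And>i. i \<in> I \<Longrightarrow> u i \<in> sections M E"
  shows "(\<lambda>p. \<Sum>i\<in>I. f i p *\<^sub>R u i p) \<in> sections M E"
  using smooth_section_on_sum[OF assms(1-3), of UNIV f u] assms(4,5)
  by (simp add: sections_def smooth_funs_def)

lemma smooth_funs_const: "(\<lambda>p. c) \<in> smooth_funs M"
  by (simp add: smooth_funs_def smooth_fun_on_const)

lemma sections_combination:
  assumes "smooth_manifold M" "vector_bundle M E" "u \<in> sections M E" "v \<in> sections M E"
  shows "(\<lambda>p. c *\<^sub>R u p + d *\<^sub>R v p) \<in> sections M E"
  \<comment> \<open>The two terms are treated as a sum indexed by \<open>bool\<close>.\<close>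
  using sections_sum[OF assms(1,2), of UNIV "\<lambda>b p. if b then c else d" "\<lambda>b. if b then u else v"]
    assms(3,4) by (simp add: smooth_funs_const UNIV_bool add.commute)

lemma E_connection_sum:
  assumes M: "smooth_manifold M" and E: "vector_bundle M E" and D: "E_connection M E \<rho> R D"
    and r: "r \<in> sections M R" and "finite I"
    and "\<And>i. i \<in> I \<Longrightarrow> f i \<in> smooth_funs M" "\<And>i. i \<in> I \<Longrightarrow> u i \<in> sections M E"
  shows "D (\<lambda>p. \<Sum>i\<in>I. f i p *\<^sub>R u i p) r = (\<lambda>p. \<Sum>i\<in>I. f i p *\<^sub>R D (u i) r p)"
  using assms(5-7)
proof (induction I rule: finite_induct)
  case empty
  have "(\<lambda>p. 0) \<in> sections M E"
    using sections_sum[OF M E, of "{}"] by simp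
  then show ?case
    using E_connectionD(2)[OF D r, of "\<lambda>p. 0" "\<lambda>p. 0" 0 0] by simp
next
  case (insert i I)
  have "(\<lambda>p. f i p *\<^sub>R u i p) \<in> sections M E"
    using sections_sum[OF M E, of "{i}" f u] insert.prems by simp
  moreover have "(\<lambda>p. \<Sum>i\<in>I. f i p *\<^sub>R u i p) \<in> sections M E"
    using insert.hyps insert.prems by (intro sections_sum[OF M E]) simp_all
  ultimately have "D (\<lambda>p. 1 *\<^sub>R (f i p *\<^sub>R u i p) + 1 *\<^sub>R (\<Sum>i\<in>I. f i p *\<^sub>R u i p)) r =
      (\<lambda>p. 1 *\<^sub>R D (\<lambda>p. f i p *\<^sub>R u i p) r p + 1 *\<^sub>R D (\<lambda>p. \<Sum>i\<in>I. f i p *\<^sub>R u i p) r p)"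
    by (rule E_connectionD(2)[OF D r])
  then show ?case
    using insert E_connectionD(3)[OF D r, of "f i" "u i"] by simp
qed

text \<open>With a bump function \<open>\<eta>\<close> supported in a frame domain, \<open>\<eta>\<^sup>2 u\<close> is a combination of global
  sections whose coefficients vanish at \<open>p\<close>.\<close>

lemma E_connection_vanishes_at:
  fixes M :: "('m::{t2_space,second_countable_topology}, 'b::euclidean_space) manifold"
  assumes M: "smooth_manifold M" and E: "vector_bundle M E" and D: "E_connection M E \<rho> R D"
    and r: "r \<in> sections M R" and u: "u \<in> sections M E" "u p = 0"
  shows "D u r p = 0"
proof -
  obtain U s where U: "(U, s) \<in> frames E" "p \<in> U" by (rule vector_bundle_frame[OF E])
  note frame = local_frameD[OF frame_is_local_frame[OF E U(1)]]
  obtain \<eta> S where \<eta>: "\<eta> \<in> smooth_funs M" "\<eta> p = 1" "closed S" "S \<subseteq> U" "\<And>q. q \<notin> S \<Longrightarrow> \<eta> q = 0"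
    using smooth_bump_exists[OF M frame(1) U(2)] by blast
  \<comment> \<open>One factor \<open>\<eta>\<close> goes into the section and the other into the
    coefficient, so that both extend by zero to smooth global objects and linearity over global
    functions applies.\<close>
  define \<sigma> where "\<sigma> a q = (if q \<in> U then \<eta> q *\<^sub>R s a q else 0)" for a q
  define f where "f a q = (if q \<in> U then \<eta> q * dual_coframe E s a q (u q) else 0)" for a q
  have \<sigma>: "\<sigma> a \<in> sections M E" if "a < rank E" for a
    unfolding \<sigma>_def[abs_def]
    by (rule extend_section_by_zero[OF M E frame(1) \<eta>(3,4,1,5) frame(2)[OF that]])
  have f: "f a \<in> smooth_funs M" if "a < rank E" for a
  proof -
    have "smooth_fun_on M (U \<inter> UNIV) (\<lambda>q. dual_coframe E s a q (u q))"
      using u(1) by (intro smooth_section_on_dual_coframe[OF M E _ U(1) that]) (simp add: sections_def)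
    moreover have "smooth_fun_on M (U \<inter> UNIV) \<eta>"
      using \<eta>(1) smooth_fun_on_subset[of M UNIV] by (simp add: smooth_funs_def)
    ultimately have "smooth_fun_on M (U \<inter> UNIV) (\<lambda>q. \<eta> q * dual_coframe E s a q (u q))"
      by (intro smooth_fun_on_mult)
    then have "smooth_fun_on M UNIV (f a)"
      unfolding f_def[abs_def] using \<eta>(5)
      by (intro smooth_fun_on_extend_by_zero[OF M frame(1) \<eta>(3,4)]) simp_all
    then show ?thesis by (simp add: smooth_funs_def)
  qed
  have "f a p = 0" for a
    using u(2) U(2) linear_between_zero[OF linear_between_dual_coframe[OF frame(3)[OF U(2)]]
        subspace_fibre[OF E]] by (simp add: f_def)
  moreover have "(\<lambda>q. (\<eta> q * \<eta> q) *\<^sub>R u q) = (\<lambda>q. \<Sum>a<rank E. f a q *\<^sub>R \<sigma> a q)"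
  proof
    fix q
    show "(\<eta> q * \<eta> q) *\<^sub>R u q = (\<Sum>a<rank E. f a q *\<^sub>R \<sigma> a q)"
    proof (cases "q \<in> U")
      case True
      have "(\<Sum>a<rank E. f a q *\<^sub>R \<sigma> a q) =
          (\<Sum>a<rank E. (\<eta> q * \<eta> q) *\<^sub>R (dual_coframe E s a q (u q) *\<^sub>R s a q))"
        using True by (simp add: f_def \<sigma>_def mult_ac)
      also have "\<dots> = (\<eta> q * \<eta> q) *\<^sub>R u q"
        using dual_coframe_expansion[OF frame(3)[OF True] sections_in_fibre[OF u(1)]]
        by (simp only: scaleR_sum_right[symmetric])
      finally show ?thesis ..
    next
      case False
      then have "\<eta> q = 0" using \<eta>(4,5) by blast
      with False show ?thesis by (simp add: f_def)
    qed
  qed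
  moreover have "(\<lambda>q. \<eta> q * \<eta> q) \<in> smooth_funs M"
    using \<eta>(1) by (simp add: smooth_funs_def smooth_fun_on_mult)
  \<comment> \<open>Both sides compute the connection along \<open>\<eta>\<^sup>2 u\<close>; at
    \<open>p\<close> the left factor is 1 and all coefficients on the right are 0.\<close>
  ultimately have "(\<eta> p * \<eta> p) *\<^sub>R D u r p = (\<Sum>a<rank E. f a p *\<^sub>R D (\<sigma> a) r p)"
    using E_connectionD(3)[OF D r, of "\<lambda>q. \<eta> q * \<eta> q" u] u(1)
      E_connection_sum[OF M E D r, of "{..<rank E}" f \<sigma>] f \<sigma> by (simp add: fun_eq_iff)
  then show ?thesis using \<eta>(2) \<open>\<And>a. f a p = 0\<close> by simp
qed

text \<open>The difference of the two sections vanishes at \<open>p\<close>. This is what makes the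
  section chosen in \<open>covariant_differential\<close> immaterial.\<close>

lemma E_connection_eq_at:
  fixes M :: "('m::{t2_space,second_countable_topology}, 'b::euclidean_space) manifold"
  assumes M: "smooth_manifold M" and E: "vector_bundle M E" and D: "E_connection M E \<rho> R D"
    and r: "r \<in> sections M R" and uv: "u \<in> sections M E" "v \<in> sections M E" "u p = v p"
  shows "D u r p = D v r p"
proof -
  have "D (\<lambda>q. 1 *\<^sub>R u q + (-1) *\<^sub>R v q) r p = 0"
    using uv by (intro E_connection_vanishes_at[OF M E D r] sections_combination[OF M E]) simp_all
  then show ?thesis
    using E_connectionD(2)[OF D r uv(1,2), of 1 "-1"] by simp
qed

lemma covariant_differential_section:
  fixes M :: "('m::{t2_space,second_countable_topology}, 'b::euclidean_space) manifold"
  assumes M: "smooth_manifold M" and E: "vector_bundle M E" and D: "E_connection M E \<rho> R D"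
    and r: "r \<in> sections M R" and u: "u \<in> sections M E"
  shows "covariant_differential M E D r p (u p) = D u r p"
  unfolding covariant_differential_def
  using section_through[OF M E sections_in_fibre[OF u]]
  by (intro E_connection_eq_at[OF M E D r _ u])

lemma linear_between_covariant_differential:
  fixes M :: "('m::{t2_space,second_countable_topology}, 'b::euclidean_space) manifold"
  assumes M: "smooth_manifold M" and E: "vector_bundle M E" and D: "E_connection M E \<rho> R D"
    and r: "r \<in> sections M R"
  shows "linear_between (fibre E p) (fibre R p) (covariant_differential M E D r p)"
  unfolding linear_between_def
proof (intro conjI ballI allI)
  fix x assume x: "x \<in> fibre E p"
  show "covariant_differential M E D r p x \<in> fibre R p"
    unfolding covariant_differential_def
    by (rule sections_in_fibre[OF E_connectionD(1)[OF D r section_through(1)[OF M E x]]])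
  fix y c d assume y: "y \<in> fibre E p"
  let ?x = "section_through M E p x" and ?y = "section_through M E p y"
  note xs = section_through[OF M E x] and ys = section_through[OF M E y]
  \<comment> \<open>The combination of the two chosen sections need not be the section chosen
    through the combined vector, but it has the same value at \<open>p\<close>.\<close>
  have "covariant_differential M E D r p (c *\<^sub>R ?x p + d *\<^sub>R ?y p) =
      D (\<lambda>q. c *\<^sub>R ?x q + d *\<^sub>R ?y q) r p"
    by (rule covariant_differential_section[OF M E D r sections_combination[OF M E xs(1) ys(1)]])
  then show "covariant_differential M E D r p (c *\<^sub>R x + d *\<^sub>R y) =
      c *\<^sub>R covariant_differential M E D r p x + d *\<^sub>R covariant_differential M E D r p y"
    using E_connectionD(2)[OF D r xs(1) ys(1)] xs(2) ys(2)
    by (simp add: covariant_differential_def)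
qed

section \<open>Admissibility and metric compatibility\<close>

lemma E_metricD:
  assumes "E_metric M E R g"
  shows "e \<in> fibre E p \<Longrightarrow> linear_between (fibre E p) (fibre R p) (g p e)"
    and "e \<in> fibre E p \<Longrightarrow> e' \<in> fibre E p \<Longrightarrow> g p e e' = g p e' e"
    and "e \<in> fibre E p \<Longrightarrow> (\<And>e'. e' \<in> fibre E p \<Longrightarrow> g p e e' = 0) \<Longrightarrow> e = 0"
    and "u \<in> sections M E \<Longrightarrow> v \<in> sections M E \<Longrightarrow> (\<lambda>q. g q (u q) (v q)) \<in> sections M R"
  using assms unfolding E_metric_def sections_def by auto

text \<open>\<open>E_metric\<close> states linearity in the second argument; symmetry transfers it
  to the first.\<close>

lemma E_metric_linear_left:
  assumes g: "E_metric M E R g" and E: "vector_bundle M E" and w: "w \<in> fibre E p"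
  shows "linear_between (fibre E p) (fibre R p) (\<lambda>e. g p e w)"
proof -
  note lin = E_metricD(1)[OF g w]
  show ?thesis
    unfolding linear_between_def
  proof (intro conjI ballI allI)
    fix x y c d assume xy: "x \<in> fibre E p" "y \<in> fibre E p"
    have "c *\<^sub>R x + d *\<^sub>R y \<in> fibre E p"
      using xy subspace_fibre[OF E] by (intro subspace_add subspace_scale)
    then show "g p (c *\<^sub>R x + d *\<^sub>R y) w = c *\<^sub>R g p x w + d *\<^sub>R g p y w"
      using linear_betweenD(2)[OF lin xy] xy E_metricD(2)[OF g w] by metis
  next
    fix x assume "x \<in> fibre E p"
    then show "g p x w \<in> fibre R p"
      using linear_betweenD(1)[OF lin] E_metricD(2)[OF g w] by metis
  qed
qed

lemma E_metric_eqI: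
  assumes g: "E_metric M E R g" and E: "vector_bundle M E"
    and xy: "x \<in> fibre E p" "y \<in> fibre E p" "\<And>w. w \<in> fibre E p \<Longrightarrow> g p x w = g p y w"
  shows "x = y"
proof -
  have "x - y = 0"
  proof (rule E_metricD(3)[OF g])
    show "x - y \<in> fibre E p" using xy subspace_fibre[OF E] by (intro subspace_diff)
    fix w assume w: "w \<in> fibre E p"
    show "g p (x - y) w = 0"
      using linear_betweenD(2)[OF E_metric_linear_left[OF g E w] xy(1,2), of 1 "-1"] xy(3)[OF w]
      by simp
  qed
  then show ?thesis by simp
qed

text \<open>The definite description needs a unique solution. Existence is representability by a
  non-degenerate form with values in the line spanned by \<open>t 0 p\<close>; uniqueness is
  non-degeneracy.\<close>

lemma g_inv_pairing:
  assumes E: "vector_bundle M E" and R: "line_bundle M R" and g: "E_metric M E R g"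
    and \<alpha>: "linear_between (fibre E p) (fibre R p) \<alpha>"
  shows "g_inv E g p \<alpha> \<in> fibre E p" and "w \<in> fibre E p \<Longrightarrow> g p (g_inv E g p \<alpha>) w = \<alpha> w"
proof -
  obtain U s where U: "(U, s) \<in> frames E" "p \<in> U" by (rule vector_bundle_frame[OF E])
  define B where "B = (\<lambda>a. s a p) ` {..<rank E}"
  have B: "finite B" "independent B" "span B = fibre E p"
    using local_frameD(3)[OF frame_is_local_frame[OF E U(1)] U(2)]
    by (auto simp: fibre_basis_def B_def)
  have R': "vector_bundle M R" "rank R = 1" using R by (simp_all add: line_bundle_def)
  obtain V t where V: "(V, t) \<in> frames R" "p \<in> V" by (rule vector_bundle_frame[OF R'(1)])
  have "fibre_basis R p t" by (rule local_frameD(3)[OF frame_is_local_frame[OF R'(1) V(1)] V(2)])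
  moreover have "{..<rank R} = {0}" using R'(2) by auto
  ultimately have t: "t 0 p \<noteq> 0" "span {t 0 p} = fibre R p"
    by (simp_all add: fibre_basis_def)
  obtain u where u: "u \<in> fibre E p" "\<And>w. w \<in> fibre E p \<Longrightarrow> g p u w = \<alpha> w"
    using nondegenerate_form_representable[OF B(1,2) t(1), of "g p" \<alpha>, unfolded B(3) t(2)]
      E_metricD(1-3)[OF g] \<alpha> by blast
  have "g_inv E g p \<alpha> \<in> fibre E p \<and> (\<forall>w\<in>fibre E p. g p (g_inv E g p \<alpha>) w = \<alpha> w)"
    unfolding g_inv_def
  proof (rule theI[where a = u])
    show "u \<in> fibre E p \<and> (\<forall>w\<in>fibre E p. g p u w = \<alpha> w)" using u by simp
    fix x assume x: "x \<in> fibre E p \<and> (\<forall>w\<in>fibre E p. g p x w = \<alpha> w)"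
    show "x = u"
    proof (rule E_metric_eqI[OF g E _ u(1)])
      show "g p x w = g p u w" if "w \<in> fibre E p" for w
        using x u(2)[OF that] that by metis
    qed (use x in blast)
  qed
  then show "g_inv E g p \<alpha> \<in> fibre E p" and "w \<in> fibre E p \<Longrightarrow> g p (g_inv E g p \<alpha>) w = \<alpha> w"
    by simp_all
qed

text \<open>Needed because a chosen one-form is prescribed only on the fibre over \<open>p\<close>,
  not as a function on the whole type \<open>'e\<close>.\<close>

lemma g_inv_cong:
  assumes "\<And>w. w \<in> fibre E p \<Longrightarrow> \<alpha> w = \<beta> w"
  shows "g_inv E g p \<alpha> = g_inv E g p \<beta>"
proof -
  have "(u \<in> fibre E p \<and> (\<forall>w\<in>fibre E p. g p u w = \<alpha> w)) \<longleftrightarrow>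
      (u \<in> fibre E p \<and> (\<forall>w\<in>fibre E p. g p u w = \<beta> w))" for u
    using assms by simp
  then show ?thesis by (simp only: g_inv_def)
qed

text \<open>\<open>RL\<close> evaluated at \<open>p\<close> sees its arguments only through their
  values there, so all three choices cancel.\<close>

lemma locality_operator_at_RL:
  fixes M :: "('m::{t2_space,second_countable_topology}, 'b::euclidean_space) manifold"
  assumes M: "smooth_manifold M" and E: "vector_bundle M E"
    and \<omega>: "linear_between (fibre E p) UNIV \<omega>" and xy: "x \<in> fibre E p" "y \<in> fibre E p"
  shows "locality_operator_at M E (RL E g) p \<omega> x y = g_inv E g p (\<lambda>w. \<omega> w *\<^sub>R g p x y)"
  unfolding locality_operator_at_def RL_def
  by (rule g_inv_cong)
    (simp add: one_form_through(2)[OF M E \<omega>] section_through(2)[OF M E xy(1)]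
      section_through(2)[OF M E xy(2)])

lemma locality_operator_at_RL_pairing:
  fixes M :: "('m::{t2_space,second_countable_topology}, 'b::euclidean_space) manifold"
  assumes M: "smooth_manifold M" and E: "vector_bundle M E" and R: "line_bundle M R"
    and g: "E_metric M E R g"
    and \<omega>: "linear_between (fibre E p) UNIV \<omega>" and xy: "x \<in> fibre E p" "y \<in> fibre E p"
  shows "locality_operator_at M E (RL E g) p \<omega> x y \<in> fibre E p"
    and "w \<in> fibre E p \<Longrightarrow> g p (locality_operator_at M E (RL E g) p \<omega> x y) w = \<omega> w *\<^sub>R g p x y"
proof -
  have "subspace (fibre R p)" using R subspace_fibre[of M R] by (simp add: line_bundle_def)
  moreover have "g p x y \<in> fibre R p" using linear_betweenD(1)[OF E_metricD(1)[OF g]] xy by blast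
  ultimately have lin: "linear_between (fibre E p) (fibre R p) (\<lambda>w. \<omega> w *\<^sub>R g p x y)"
    using linear_betweenD(2)[OF \<omega>]
    by (simp add: linear_between_def subspace_scale scaleR_left_distrib)
  show "locality_operator_at M E (RL E g) p \<omega> x y \<in> fibre E p"
    and "w \<in> fibre E p \<Longrightarrow> g p (locality_operator_at M E (RL E g) p \<omega> x y) w = \<omega> w *\<^sub>R g p x y"
    unfolding locality_operator_at_RL[OF M E \<omega> xy]
    by (rule g_inv_pairing[OF E R g lin], rule g_inv_pairing(2)[OF E R g lin])
qed

text \<open>Contracting \<open>e\<^sup>a \<otimes> \<nabla>\<^bsub>X\<^sub>a\<^esub> u\<close> with \<open>w\<close> gives \<open>\<nabla>\<^bsub>w\<^esub> u\<close>, whence the frame drops out.\<close>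

lemma frame_sum_pairing:
  fixes M :: "('m::{t2_space,second_countable_topology}, 'b::euclidean_space) manifold"
  assumes M: "smooth_manifold M" and E: "vector_bundle M E" and R: "line_bundle M R"
    and g: "E_metric M E R g" and X: "fibre_basis E p X"
    and N: "linear_between (fibre E p) (fibre E p) N" and y: "y \<in> fibre E p" and w: "w \<in> fibre E p"
  shows "g p (\<Sum>a<rank E. locality_operator_at M E (RL E g) p (dual_coframe E X a p) (N (X a p)) y) w
    = g p (N w) y"
proof -
  have NX: "N (X a p) \<in> fibre E p" if "a < rank E" for a
    by (rule linear_betweenD(1)[OF N fibre_basis_in_fibre[OF X that]])
  note L = locality_operator_at_RL_pairing[OF M E R g linear_between_dual_coframe[OF X] NX y]
  let ?L = "\<lambda>a. locality_operator_at M E (RL E g) p (dual_coframe E X a p) (N (X a p)) y"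
  have "g p (\<Sum>a<rank E. 1 *\<^sub>R ?L a) w = (\<Sum>a<rank E. 1 *\<^sub>R g p (?L a) w)"
    by (rule linear_between_sum[OF E_metric_linear_left[OF g E w] subspace_fibre[OF E]])
      (simp_all add: L(1))
  also have "\<dots> = (\<Sum>a<rank E. dual_coframe E X a p w *\<^sub>R g p (N (X a p)) y)"
    by (intro sum.cong) (simp_all add: L(2)[OF _ w])
  also have "\<dots> = g p (\<Sum>a<rank E. dual_coframe E X a p w *\<^sub>R N (X a p)) y"
    by (rule linear_between_sum[OF E_metric_linear_left[OF g E y] subspace_fibre[OF E], symmetric])
      (simp_all add: NX)
  \<comment> \<open>Linearity of \<open>N\<close> moves the coefficients inside, where they
    recombine to the expansion of \<open>w\<close> in the frame.\<close>
  also have "(\<Sum>a<rank E. dual_coframe E X a p w *\<^sub>R N (X a p)) =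
      N (\<Sum>a<rank E. dual_coframe E X a p w *\<^sub>R X a p)"
    by (rule linear_between_sum[OF N subspace_fibre[OF E], symmetric])
      (simp_all add: fibre_basis_in_fibre[OF X])
  finally show ?thesis by (simp add: dual_coframe_expansion[OF X w])
qed

theorem proposition3p7:
  fixes M :: "('m::{t2_space,second_countable_topology}, 'b::euclidean_space) manifold"
    and E :: "('m, 'e::real_vector) vbundle"
    and R :: "('m, 'r::real_vector) vbundle"
    and \<rho> :: "'m \<Rightarrow> 'e \<Rightarrow> ('m \<Rightarrow> real) \<Rightarrow> real"
    and br :: "('m \<Rightarrow> 'e) \<Rightarrow> ('m \<Rightarrow> 'e) \<Rightarrow> ('m \<Rightarrow> 'e)"
    and g :: "'m \<Rightarrow> 'e \<Rightarrow> 'e \<Rightarrow> 'r"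
    and D :: "('m \<Rightarrow> 'e) \<Rightarrow> ('m \<Rightarrow> 'r) \<Rightarrow> ('m \<Rightarrow> 'r)"
    and nabla :: "('m \<Rightarrow> 'e) \<Rightarrow> ('m \<Rightarrow> 'e) \<Rightarrow> ('m \<Rightarrow> 'e)"
  assumes "smooth_manifold M"
    and "conformal_Courant_algebroid M E \<rho> br R g D"
    and "linear_E_connection M E \<rho> nabla"
  shows "admissible M E br (RL E g) nabla \<longleftrightarrow> metric_compatible M E g D nabla"
proof -
  note M = assms(1) and Courant = assms(2)[unfolded conformal_Courant_algebroid_def]
  have E: "vector_bundle M E"
    using Courant by (simp add: Leibniz_algebroid_def almost_Leibniz_algebroid_def anchored_bundle_def)
  from Courant have R: "line_bundle M R" and g: "E_metric M E R g" and D: "E_connection M E \<rho> R D"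
    by blast+
  from Courant have bracket: "br u v p + br v u p =
      g_inv E g p (covariant_differential M E D (\<lambda>q. g q (u q) (v q)) p)"
    if "u \<in> sections M E" "v \<in> sections M E" for u v p
    using that by blast
  have N: "E_connection M E \<rho> E nabla"
    using assms(3) by (simp add: linear_E_connection_def)
  let ?Dg = "\<lambda>u v. covariant_differential M E D (\<lambda>q. g q (u q) (v q))"
    and ?N = "covariant_differential M E nabla"
  have Dg_lin: "linear_between (fibre E p) (fibre R p) (?Dg u v p)"
    if "u \<in> sections M E" "v \<in> sections M E" for u v p
    by (rule linear_between_covariant_differential[OF M E D E_metricD(4)[OF g that]])
  have N_lin: "linear_between (fibre E p) (fibre E p) (?N u p)" if "u \<in> sections M E" for u p
    by (rule linear_between_covariant_differential[OF M E N that])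
  define A where "A X u v p = (\<Sum>a<rank E.
       locality_operator_at M E (RL E g) p (dual_coframe E X a p) (?N u p (X a p)) (v p) +
       locality_operator_at M E (RL E g) p (dual_coframe E X a p) (?N v p (X a p)) (u p))" for X u v p
  \<comment> \<open>Both sides of the admissibility equation lie in the fibre, so they are equal as
    soon as their pairings with every \<open>w\<close> are. The resulting condition no longer
    mentions \<open>X\<close>.\<close>
  have admissible_at: "br u v p + br v u p = A X u v p \<longleftrightarrow>
      (\<forall>w\<in>fibre E p. ?Dg u v p w = g p (?N u p w) (v p) + g p (u p) (?N v p w))"
    if uv: "u \<in> sections M E" "v \<in> sections M E" and X: "fibre_basis E p X" for u v p X
  proof -
    note up = sections_in_fibre[OF uv(1)] and vp = sections_in_fibre[OF uv(2)]
    note N_in = linear_betweenD(1)[OF N_lin]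
    let ?S = "\<lambda>u v. \<Sum>a<rank E.
      locality_operator_at M E (RL E g) p (dual_coframe E X a p) (?N u p (X a p)) (v p)"
    have S_in: "?S u v \<in> fibre E p" if "u \<in> sections M E" "v \<in> sections M E" for u v
      using locality_operator_at_RL_pairing(1)[OF M E R g linear_between_dual_coframe[OF X]
          N_in[OF that(1) fibre_basis_in_fibre[OF X]] sections_in_fibre[OF that(2)]]
      by (intro subspace_sum subspace_fibre[OF E]) simp
    have A_sum: "A X u v p = ?S u v + ?S v u" by (simp add: A_def sum.distrib)
    then have A_in: "A X u v p \<in> fibre E p"
      using subspace_add[OF subspace_fibre[OF E] S_in[OF uv] S_in[OF uv(2,1)]] by simp
    have A_pairing: "g p (A X u v p) w = g p (?N u p w) (v p) + g p (u p) (?N v p w)"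
      if w: "w \<in> fibre E p" for w
    proof -
      have "g p (A X u v p) w = g p (?S u v) w + g p (?S v u) w"
        unfolding A_sum
        by (rule linear_between_add[OF E_metric_linear_left[OF g E w] S_in[OF uv] S_in[OF uv(2,1)]])
      also have "\<dots> = g p (?N u p w) (v p) + g p (?N v p w) (u p)"
        by (simp only: frame_sum_pairing[OF M E R g X N_lin[OF uv(1)] vp w]
            frame_sum_pairing[OF M E R g X N_lin[OF uv(2)] up w])
      finally show ?thesis
        by (simp only: E_metricD(2)[OF g N_in[OF uv(2) w] up])
    qed
    note br_pairing = g_inv_pairing[OF E R g Dg_lin[OF uv, of p]]
    show ?thesis
      unfolding bracket[OF uv]
    proof
      assume eq: "g_inv E g p (?Dg u v p) = A X u v p"
      show "\<forall>w\<in>fibre E p. ?Dg u v p w = g p (?N u p w) (v p) + g p (u p) (?N v p w)"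
        using br_pairing(2) A_pairing unfolding eq by simp
    next
      assume "\<forall>w\<in>fibre E p. ?Dg u v p w = g p (?N u p w) (v p) + g p (u p) (?N v p w)"
      then show "g_inv E g p (?Dg u v p) = A X u v p"
        using br_pairing(2) A_pairing by (intro E_metric_eqI[OF g E br_pairing(1) A_in]) simp
    qed
  qed
  have Dg_section: "?Dg v w p (u p) = D u (\<lambda>q. g q (v q) (w q)) p"
    and N_section: "?N v p (u p) = nabla u v p"
    if "u \<in> sections M E" "v \<in> sections M E" "w \<in> sections M E" for u v w p
    using covariant_differential_section[OF M E D E_metricD(4)[OF g that(2,3)] that(1)]
      covariant_differential_section[OF M E N that(2,1)] by simp_all
  \<comment> \<open>The direction, a section in the definition, becomes a vector \<open>e\<close> of
    the fibre: every \<open>e\<close> is the value of a global section, and both sides depend on the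
    direction only through that value.\<close>
  have compatible: "metric_compatible M E g D nabla \<longleftrightarrow>
      (\<forall>v\<in>sections M E. \<forall>w\<in>sections M E. \<forall>p. \<forall>e\<in>fibre E p.
         ?Dg v w p e = g p (?N v p e) (w p) + g p (v p) (?N w p e))" (is "_ \<longleftrightarrow> ?C")
  proof
    assume C: "metric_compatible M E g D nabla"
    show ?C
    proof (intro ballI allI)
      fix v w p e assume vw: "v \<in> sections M E" "w \<in> sections M E" and e: "e \<in> fibre E p"
      let ?u = "section_through M E p e"
      note u = section_through[OF M E e]
      have "D ?u (\<lambda>q. g q (v q) (w q)) p = g p (nabla ?u v p) (w p) + g p (v p) (nabla ?u w p)"
        using C u(1) vw by (simp add: metric_compatible_def)
      then show "?Dg v w p e = g p (?N v p e) (w p) + g p (v p) (?N w p e)"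
        using Dg_section[OF u(1) vw, of p] N_section[OF u(1) vw, of p]
          N_section[OF u(1) vw(2,1), of p] u(2) by simp
    qed
  next
    assume C: ?C
    show "metric_compatible M E g D nabla"
      unfolding metric_compatible_def
    proof (intro ballI allI)
      fix u v w p assume uvw: "u \<in> sections M E" "v \<in> sections M E" "w \<in> sections M E"
      show "D u (\<lambda>q. g q (v q) (w q)) p = g p (nabla u v p) (w p) + g p (v p) (nabla u w p)"
        using bspec[OF spec[OF bspec[OF bspec[OF C uvw(2)] uvw(3)]] sections_in_fibre[OF uvw(1)], of p]
        by (simp only: Dg_section[OF uvw] N_section[OF uvw] N_section[OF uvw(1,3,2)])
    qed
  qed
  show ?thesis
  proof
    assume adm: "admissible M E br (RL E g) nabla"
    show "metric_compatible M E g D nabla"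
      unfolding compatible
    proof (intro ballI allI)
      fix u v p e assume uv: "u \<in> sections M E" "v \<in> sections M E" and e: "e \<in> fibre E p"
      \<comment> \<open>Admissibility speaks of all local frames; a single one around
        \<open>p\<close> suffices here.\<close>
      obtain U X where U: "(U, X) \<in> frames E" "p \<in> U" by (rule vector_bundle_frame[OF E])
      note frame = frame_is_local_frame[OF E U(1)]
      have "br u v p + br v u p = A X u v p"
        using adm uv frame U(2) unfolding admissible_def A_def by blast
      then show "?Dg u v p e = g p (?N u p e) (v p) + g p (u p) (?N v p e)"
        using admissible_at[OF uv local_frameD(3)[OF frame U(2)]] e by simp
    qed
  next
    assume C: "metric_compatible M E g D nabla"
    \<comment> \<open>Conversely every local frame is reached, because the right-hand side of
      \<open>admissible_at\<close> is independent of the frame.\<close>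
    have "br u v p + br v u p = A X u v p"
      if "u \<in> sections M E" "v \<in> sections M E" "local_frame M E U X" "p \<in> U" for u v U X p
      using C[unfolded compatible] that(1,2)
        admissible_at[OF that(1,2) local_frameD(3)[OF that(3,4)]] by simp
    then show "admissible M E br (RL E g) nabla"
      unfolding admissible_def A_def by blast
  qed
qed

end
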